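(* Let $\mathcal{A}$ be a $C^*$-algebra and let $\{x_j\}_{j\in J}$ be a frame in $\mathcal{A}$ (regarded as a Hilbert module over itself). Then the net of finite partial sums of $\sum_{j\in J}x_jx_j^*$ is bounded in norm; that is, the net $\left\{\sum_{j\in J_\theta}x_jx_j^*\right\}_{\theta\in\Theta}$, where $J_\theta$ runs over all finite subsets of $J$ ($\Theta$ being the set of all finite subsets of $J$), is bounded in norm.
   Context: $\dot{\mathcal{A}}$ denotes the unitalization of $\mathcal{A}$ (equal to $\mathcal{A}$ if $\mathcal{A}$ is unital). $\mathcal{A}$ is a right Hilbert module over itself and over $\dot{\mathcal{A}}$, with inner product $\langle a,b\rangle=a^*b$. When $\mathcal{A}$ is not unital, frames in $\mathcal{A}$ are understood with $\mathcal{A}$ regarded as a Hilbert $\dot{\mathcal{A}}$-module. Frame: let $\mathcal{N}$ be a Hilbert $C^*$-module over a unital $C^*$-algebra $\mathcal{B}$. A family $\{x_j\}_{j\in J}\subset\mathcal{N}$ is a standard frame if there are constants $c_1,c_2>0$ such that for every $x\in\mathcal{N}$ the series $\sum_j\langle x,x_j\rangle\langle x_j,x\rangle$ converges in norm and $c_1\langle x,x\rangle\le\sum_j\langle x,x_j\rangle\langle x_j,x\rangle\le c_2\langle x,x\rangle$. If the series (as the net of its finite partial sums) is only required to converge in the ultraweak ($\sigma$-weak) topology (of the universal enveloping von Neumann algebra of $\mathcal{B}$), the family is a non-standard frame. "Frame" means at least a non-standard frame. Equivalently (a known criterion), $\{x_j\}_{j\in J}$ is a frame iff there are $c_1,c_2>0$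 with $c_1\varphi(\langle x,x\rangle)\le\sum_{j}\varphi(\langle x,x_j\rangle\langle x_j,x\rangle)\le c_2\varphi(\langle x,x\rangle)$ for all $x\in\mathcal{N}$ and all states $\varphi$ of $\mathcal{B}$. *)

theory Defs
  imports "HOL-Analysis.Analysis"
begin

section \<open>C*-algebras\<close>

class cstar_algebra = real_normed_algebra + complete_space +
  fixes scaleC :: "complex \<Rightarrow> 'a \<Rightarrow> 'a"  (infixr "*\<^sub>C" 75)
    and star :: "'a \<Rightarrow> 'a"
  assumes scaleC_add_right: "c *\<^sub>C (a + b) = c *\<^sub>C a + c *\<^sub>C b"
    and scaleC_add_left: "(c + d) *\<^sub>C a = c *\<^sub>C a + d *\<^sub>C a"
    and scaleC_scaleC: "c *\<^sub>C (d *\<^sub>C a) = (c * d) *\<^sub>C a"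
    and scaleC_of_real: "complex_of_real r *\<^sub>C a = scaleR r a"
    and norm_scaleC: "norm (c *\<^sub>C a) = cmod c * norm a"
    and scaleC_mult_left: "(c *\<^sub>C a) * b = c *\<^sub>C (a * b)"
    and scaleC_mult_right: "a * (c *\<^sub>C b) = c *\<^sub>C (a * b)"
    and star_star: "star (star a) = a"
    and star_add: "star (a + b) = star a + star b"
    and star_scaleC: "star (c *\<^sub>C a) = cnj c *\<^sub>C star a"
    and star_mult: "star (a * b) = star b * star a"
    and cstar_identity: "norm (star a * a) = (norm a)\<^sup>2"
begin

subclass banach ..

end

text \<open>The zero algebra counts as unital, hence the unit is a predicate and not taken from the
  class \<^class>\<open>one\<close>.\<close>

definition is_unit_element :: "'a::cstar_algebra \<Rightarrow> bool" where
  "is_unit_element e \<longleftrightarrow> (\<forall>a. e * a = a \<and> a * e = a)"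

definition unital :: "'a::cstar_algebra itself \<Rightarrow> bool" where
  "unital _ \<longleftrightarrow> (\<exists>e::'a. is_unit_element e)"

lemma scaleC_one [simp]: "1 *\<^sub>C (a::'a::cstar_algebra) = a"
  using scaleC_of_real[of 1 a] by simp

lemma scaleC_zero_left [simp]: "0 *\<^sub>C (a::'a::cstar_algebra) = 0"
  using scaleC_of_real[of 0 a] by simp

lemma scaleC_minus_left: "(- c) *\<^sub>C (a::'a::cstar_algebra) = - (c *\<^sub>C a)"
  using scaleC_add_left[of "-c" c a] by (simp add: eq_neg_iff_add_eq_0)

lemma scaleC_zero_right [simp]: "c *\<^sub>C (0::'a::cstar_algebra) = 0"
  using scaleC_add_right[of c 0 0] by simp

lemma scaleC_minus_right: "c *\<^sub>C (- (a::'a::cstar_algebra)) = - (c *\<^sub>C a)"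
  using scaleC_add_right[of c "-a" a] by (simp add: eq_neg_iff_add_eq_0)

lemma scaleC_diff_right: "c *\<^sub>C ((a::'a::cstar_algebra) - b) = c *\<^sub>C a - c *\<^sub>C b"
  using scaleC_add_right[of c a "-b"] by (simp add: scaleC_minus_right)

lemma star_zero [simp]: "star (0::'a::cstar_algebra) = 0"
  using star_add[of 0 "0::'a"] by simp

lemma norm_star [simp]: "norm (star a) = norm (a::'a::cstar_algebra)"
proof -
  have *: "norm b \<le> norm (star b)" for b :: 'a
  proof (cases "b = 0")
    case False
    have "norm b * norm b \<le> norm (star b) * norm b"
      using norm_mult_ineq[of "star b" b] by (simp add: cstar_identity power2_eq_square)
    then show ?thesis using False by simp
  qed simp
  show ?thesis using *[of a] *[of "star a"] by (simp add: star_star)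
qed


section \<open>Unitalization\<close>

datatype 'a unitization = Unitization (alg_part: 'a) (scalar_part: complex)

definition unit_act :: "'a::cstar_algebra unitization \<Rightarrow> 'a \<Rightarrow> 'a" where
  "unit_act u b = alg_part u * b + scalar_part u *\<^sub>C b"

definition op_norm :: "'a::cstar_algebra unitization \<Rightarrow> real" where
  "op_norm u = (SUP b\<in>{b. norm b \<le> 1}. norm (unit_act u b))"

lemma unit_act_norm_le:
  "norm (unit_act u b) \<le> (norm (alg_part u) + cmod (scalar_part u)) * norm b"
  unfolding unit_act_def
  by (rule order_trans[OF norm_triangle_ineq])
     (simp add: norm_scaleC distrib_right add_mono norm_mult_ineq)

lemma unit_act_scaleC: "unit_act u (c *\<^sub>C b) = c *\<^sub>C unit_act u b"
  by (simp add: unit_act_def scaleC_mult_right scaleC_scaleC scaleC_add_right mult.commute)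

lemma op_norm_bdd: "bdd_above ((\<lambda>b. norm (unit_act u b)) ` {b. norm b \<le> 1})"
proof (rule bdd_aboveI2)
  fix b :: 'a assume "b \<in> {b. norm b \<le> 1}"
  then show "norm (unit_act u b) \<le> norm (alg_part u) + cmod (scalar_part u)"
    using unit_act_norm_le[of u b]
      mult_left_mono[of "norm b" 1 "norm (alg_part u) + cmod (scalar_part u)"] by simp
qed

lemma op_norm_le: "(\<And>b. norm b \<le> 1 \<Longrightarrow> norm (unit_act u b) \<le> K) \<Longrightarrow> op_norm u \<le> K"
  unfolding op_norm_def by (rule cSUP_least) (auto intro: exI[of _ 0])

lemma op_norm_nonneg: "0 \<le> op_norm u"
proof -
  have "norm (unit_act u 0) \<le> op_norm u"
    unfolding op_norm_def by (rule cSUP_upper[OF _ op_norm_bdd]) simp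
  then show ?thesis using norm_ge_zero order_trans by blast
qed

lemma op_norm_bound: "norm (unit_act u b) \<le> op_norm u * norm b"
proof (cases "b = 0")
  case False
  let ?r = "complex_of_real (1 / norm b)"
  have "norm (unit_act u (?r *\<^sub>C b)) \<le> op_norm u"
    unfolding op_norm_def by (rule cSUP_upper[OF _ op_norm_bdd]) (simp add: norm_scaleC norm_divide)
  then show ?thesis using False
    by (simp add: unit_act_scaleC norm_scaleC norm_divide field_simps)
qed (simp add: unit_act_def)

lemma op_norm_le_parts: "op_norm u \<le> norm (alg_part u) + cmod (scalar_part u)"
proof (rule op_norm_le)
  fix b :: 'a assume "norm b \<le> 1"
  then show "norm (unit_act u b) \<le> norm (alg_part u) + cmod (scalar_part u)"
    using unit_act_norm_le[of u b]
      mult_left_mono[of "norm b" 1 "norm (alg_part u) + cmod (scalar_part u)"] by simp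
qed

lemma op_norm_alg: "op_norm (Unitization a 0) = norm a"
proof (rule antisym)
  show "op_norm (Unitization a 0) \<le> norm a" using op_norm_le_parts[of "Unitization a 0"] by simp
  have "norm (a * star a) \<le> op_norm (Unitization a 0) * norm a"
    using op_norm_bound[of "Unitization a 0" "star a"] by (simp add: unit_act_def)
  moreover have "norm (a * star a) = norm a * norm a"
    using cstar_identity[of "star a"] by (simp add: star_star power2_eq_square)
  ultimately show "norm a \<le> op_norm (Unitization a 0)"
    by (cases "a = 0") (auto simp: op_norm_nonneg)
qed

lemma op_norm_scaleC:
  "op_norm (Unitization (c *\<^sub>C alg_part u) (c * scalar_part u)) = cmod c * op_norm u"
proof -
  have le: "op_norm (Unitization (c *\<^sub>C alg_part u) (c * scalar_part u)) \<le> cmod c * op_norm u"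
    for c and u :: "'a unitization"
  proof (rule op_norm_le)
    fix b :: 'a assume b: "norm b \<le> 1"
    have "unit_act (Unitization (c *\<^sub>C alg_part u) (c * scalar_part u)) b = c *\<^sub>C unit_act u b"
      by (simp add: unit_act_def scaleC_add_right scaleC_scaleC scaleC_mult_left)
    moreover have "norm (unit_act u b) \<le> op_norm u"
      using op_norm_bound[of u b] mult_left_mono[OF b op_norm_nonneg[of u]] by simp
    ultimately show "norm (unit_act (Unitization (c *\<^sub>C alg_part u) (c * scalar_part u)) b)
        \<le> cmod c * op_norm u"
      by (simp add: norm_scaleC mult_left_mono)
  qed
  show ?thesis
  proof (cases "c = 0")
    case True
    then show ?thesis
      using le[of 0 u] op_norm_nonneg[of "Unitization (c *\<^sub>C alg_part u) (c * scalar_part u)"]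
      by simp
  next
    case False
    have "op_norm u
        \<le> cmod (inverse c) * op_norm (Unitization (c *\<^sub>C alg_part u) (c * scalar_part u))"
      using le[of "inverse c" "Unitization (c *\<^sub>C alg_part u) (c * scalar_part u)"] False
      by (simp add: scaleC_scaleC mult.assoc[symmetric])
    then show ?thesis using le[of c u] False
      by (simp add: norm_divide norm_inverse field_simps)
  qed
qed

text \<open>The maximum makes the norm definite also over an algebra that already has a unit; over a
  non-unital algebra the norm is the usual operator norm \<^const>\<open>op_norm\<close>, see
  \<open>norm_unitization_nonunital\<close> below.\<close>

instantiation unitization :: (cstar_algebra) real_normed_algebra
begin

definition "0 = Unitization 0 0"
definition "u + v = Unitization (alg_part u + alg_part v) (scalar_part u + scalar_part v)"
definition "- u = Unitization (- alg_part u) (- scalar_part u)"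
definition "u - v = Unitization (alg_part u - alg_part v) (scalar_part u - scalar_part v)"
definition "r *\<^sub>R u = Unitization (r *\<^sub>R alg_part u) (r *\<^sub>R scalar_part u)"
definition "u * v = Unitization
   (alg_part u * alg_part v + scalar_part u *\<^sub>C alg_part v + scalar_part v *\<^sub>C alg_part u)
   (scalar_part u * scalar_part v)"
definition "norm (u::'a unitization) = max (op_norm u) (cmod (scalar_part u))"
definition "dist u v = norm (u - v :: 'a unitization)"
definition "sgn (u::'a unitization) = inverse (norm u) *\<^sub>R u"
definition [code del]:
  "uniformity = (INF e\<in>{0<..}. principal {(u, v). dist u v < (e::real)} :: ('a unitization \<times> 'a unitization) filter)"
definition [code del]:
  "open (U :: 'a unitization set) \<longleftrightarrow> (\<forall>x\<in>U. \<forall>\<^sub>F (x', y) in uniformity. x' = x \<longrightarrow> y \<in> U)"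

lemmas unitization_ops = zero_unitization_def plus_unitization_def uminus_unitization_def
  minus_unitization_def scaleR_unitization_def times_unitization_def

lemma unit_act_add: "unit_act (u + v) b = unit_act u b + unit_act v b"
  by (simp add: unit_act_def unitization_ops distrib_right scaleC_add_left)

lemma unit_act_mult: "unit_act (u * v) b = unit_act u (unit_act v b)"
  by (simp add: unit_act_def unitization_ops distrib_right distrib_left scaleC_add_right
      scaleC_scaleC scaleC_mult_left scaleC_mult_right mult.assoc add_ac)

lemma op_norm_mult: "op_norm (u * v) \<le> op_norm u * op_norm v"
proof (rule op_norm_le)
  fix b :: 'a assume b: "norm b \<le> 1"
  have "norm (unit_act (u * v) b) \<le> op_norm u * norm (unit_act v b)"
    by (simp add: unit_act_mult op_norm_bound)
  also have "\<dots> \<le> op_norm u * (op_norm v * norm b)"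
    by (intro mult_left_mono op_norm_bound op_norm_nonneg)
  also have "\<dots> \<le> op_norm u * (op_norm v * 1)"
    by (intro mult_left_mono op_norm_nonneg b)
  finally show "norm (unit_act (u * v) b) \<le> op_norm u * op_norm v" by simp
qed

lemma norm_alg_part_le: "norm (alg_part u) \<le> 2 * norm (u :: 'a unitization)"
proof -
  have "op_norm (Unitization (alg_part u) 0) \<le> op_norm u + cmod (scalar_part u)"
  proof (rule op_norm_le)
    fix b :: 'a assume b: "norm b \<le> 1"
    have "norm (unit_act (Unitization (alg_part u) 0) b)
        = norm (unit_act u b - scalar_part u *\<^sub>C b)"
      by (simp add: unit_act_def)
    also have "\<dots> \<le> norm (unit_act u b) + cmod (scalar_part u) * norm b"
      using norm_triangle_ineq4[of "unit_act u b" "scalar_part u *\<^sub>C b"] by (simp add: norm_scaleC)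
    also have "\<dots> \<le> op_norm u * norm b + cmod (scalar_part u) * norm b"
      by (intro add_right_mono op_norm_bound)
    also have "\<dots> \<le> op_norm u * 1 + cmod (scalar_part u) * 1"
      using b by (intro add_mono mult_left_mono op_norm_nonneg) auto
    finally show "norm (unit_act (Unitization (alg_part u) 0) b) \<le> op_norm u + cmod (scalar_part u)"
      by simp
  qed
  then show ?thesis by (simp add: op_norm_alg norm_unitization_def)
qed

lemma norm_unitization_le: "norm (u :: 'a unitization) \<le> norm (alg_part u) + cmod (scalar_part u)"
  using op_norm_le_parts[of u] by (simp add: norm_unitization_def)

instance
proof
  fix u v w :: "'a unitization" and r s :: real and c d :: complex
  show "u + v + w = u + (v + w)" "u + v = v + u" "0 + u = u" "- u + u = 0" "u - v = u + - v"
    by (simp_all add: unitization_ops add_ac unitization.expand)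
  show "r *\<^sub>R (u + v) = r *\<^sub>R u + r *\<^sub>R v" "(r + s) *\<^sub>R u = r *\<^sub>R u + s *\<^sub>R u"
    "r *\<^sub>R s *\<^sub>R u = (r * s) *\<^sub>R u" "1 *\<^sub>R u = u"
    by (simp_all add: unitization_ops algebra_simps)
  show "u * v * w = u * (v * w)"
    by (simp add: unitization_ops distrib_left distrib_right scaleC_add_right scaleC_scaleC
        scaleC_mult_left scaleC_mult_right mult_ac(1) add_ac mult.commute mult.left_commute[of _ _ "_::complex"])
  show "(u + v) * w = u * w + v * w" "u * (v + w) = u * v + u * w"
    by (simp_all add: unitization_ops distrib_left distrib_right scaleC_add_left scaleC_add_right
        add_ac)
  show "r *\<^sub>R u * v = r *\<^sub>R (u * v)" "u * r *\<^sub>R v = r *\<^sub>R (u * v)"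
    by (simp_all add: unitization_ops scaleR_add_right scaleC_of_real[symmetric] scaleC_scaleC
        scaleC_mult_left scaleC_mult_right scaleC_add_right scaleR_conv_of_real mult_ac)
  show "dist u v = norm (u - v)" "sgn u = inverse (norm u) *\<^sub>R u"
    by (simp_all add: dist_unitization_def sgn_unitization_def)
  show "uniformity = (INF e\<in>{0<..}. principal {(x, y). dist (x::'a unitization) y < (e::real)})"
    by (rule uniformity_unitization_def)
  show "open U \<longleftrightarrow> (\<forall>x\<in>U. \<forall>\<^sub>F (x', y) in uniformity. x' = x \<longrightarrow> y \<in> U)" for U :: "'a unitization set"
    by (rule open_unitization_def)
  show "norm u = 0 \<longleftrightarrow> u = 0"
  proof
    assume n: "norm u = 0"
    then have "alg_part u = 0" using norm_alg_part_le[of u] by simp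
    moreover have "scalar_part u = 0"
      using n op_norm_nonneg[of u] unfolding norm_unitization_def
      by (metis max.cobounded2 norm_le_zero_iff)
    ultimately show "u = 0" by (simp add: zero_unitization_def unitization.expand)
  next
    assume "u = 0"
    then show "norm u = 0"
      using op_norm_alg[of "0::'a"] by (simp add: norm_unitization_def zero_unitization_def)
  qed
  have tri: "op_norm (u + v) \<le> op_norm u + op_norm v"
  proof (rule op_norm_le)
    fix b :: 'a assume b: "norm b \<le> 1"
    have "norm (unit_act (u + v) b) \<le> op_norm u * norm b + op_norm v * norm b"
      unfolding unit_act_add by (intro norm_triangle_mono op_norm_bound)
    also have "\<dots> \<le> op_norm u * 1 + op_norm v * 1"
      by (intro add_mono mult_left_mono op_norm_nonneg b)
    finally show "norm (unit_act (u + v) b) \<le> op_norm u + op_norm v" by simp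
  qed
  show "norm (u + v) \<le> norm u + norm v"
    unfolding norm_unitization_def
    using tri norm_triangle_ineq[of "scalar_part u" "scalar_part v"]
    by (auto simp: plus_unitization_def max_def)
  have "op_norm (r *\<^sub>R u) = \<bar>r\<bar> * op_norm u"
    using op_norm_scaleC[of "complex_of_real r" u]
    by (simp add: scaleR_unitization_def scaleC_of_real scaleR_conv_of_real)
  then show "norm (r *\<^sub>R u) = \<bar>r\<bar> * norm u"
    by (simp add: norm_unitization_def scaleR_unitization_def max_mult_distrib_left)
  show "norm (u * v) \<le> norm u * norm v"
  proof -
    have "op_norm (u * v) \<le> norm u * norm v"
      by (rule order_trans[OF op_norm_mult])
        (auto simp: norm_unitization_def op_norm_nonneg intro!: mult_mono max.coboundedI1)
    moreover have "cmod (scalar_part (u * v)) \<le> norm u * norm v"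
      by (auto simp: times_unitization_def norm_mult norm_unitization_def op_norm_nonneg
          intro!: mult_mono max.coboundedI2)
    ultimately show ?thesis by (simp add: norm_unitization_def)
  qed
qed

end

instantiation unitization :: (cstar_algebra) cstar_algebra
begin

definition "c *\<^sub>C u = Unitization (c *\<^sub>C alg_part u) (c * scalar_part u)"
definition "star u = Unitization (star (alg_part u)) (cnj (scalar_part u))"

lemmas unitization_ops' = unitization_ops scaleC_unitization_def star_unitization_def

lemma op_norm_star_mult_ge: "(op_norm u)\<^sup>2 \<le> op_norm (star u * u)"
proof -
  have "op_norm u \<le> sqrt (op_norm (star u * u))"
  proof (rule op_norm_le)
    fix b :: 'a assume b: "norm b \<le> 1"
    have "star (unit_act u b) * unit_act u b = star b * unit_act (star u * u) b"
      by (simp add: unit_act_def unitization_ops' star_add star_mult star_scaleC distrib_left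
          distrib_right scaleC_mult_left scaleC_mult_right scaleC_scaleC scaleC_add_right
          mult.assoc add_ac mult.commute)
    then have "(norm (unit_act u b))\<^sup>2 = norm (star b * unit_act (star u * u) b)"
      by (metis cstar_identity)
    also have "\<dots> \<le> norm b * norm (unit_act (star u * u) b)"
      using norm_mult_ineq[of "star b"] by simp
    also have "\<dots> \<le> 1 * (op_norm (star u * u) * norm b)"
      using b by (intro mult_mono op_norm_bound) auto
    also have "\<dots> \<le> op_norm (star u * u)"
      using b mult_left_mono[OF b op_norm_nonneg[of "star u * u"]] by simp
    finally show "norm (unit_act u b) \<le> sqrt (op_norm (star u * u))"
      by (rule real_le_rsqrt)
  qed
  then have "(op_norm u)\<^sup>2 \<le> (sqrt (op_norm (star u * u)))\<^sup>2"
    by (rule power_mono) (rule op_norm_nonneg)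
  then show ?thesis by (simp add: op_norm_nonneg)
qed

lemma op_norm_star_mult: "op_norm (star u * u) = (op_norm u)\<^sup>2"
proof -
  have le: "op_norm v \<le> op_norm (star v)" for v :: "'a unitization"
  proof (cases "op_norm v = 0")
    case False
    have "op_norm v * op_norm v \<le> op_norm (star v) * op_norm v"
      using op_norm_star_mult_ge[of v] op_norm_mult[of "star v" v] by (simp add: power2_eq_square)
    then show ?thesis using False op_norm_nonneg[of v] by simp
  qed (simp add: op_norm_nonneg)
  have "op_norm (star u) = op_norm u"
    using le[of u] le[of "star u"] by (simp add: unitization_ops' star_star)
  then show ?thesis
    using op_norm_star_mult_ge[of u] op_norm_mult[of "star u" u] by (simp add: power2_eq_square)
qed

lemma unitization_Cauchy_converges:
  fixes X :: "nat \<Rightarrow> 'a unitization"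
  assumes C: "\<And>e. 0 < e \<Longrightarrow> \<exists>M. \<forall>m\<ge>M. \<forall>n\<ge>M. norm (X m - X n) < e"
  shows "\<exists>L. \<forall>e>0. \<exists>M. \<forall>n\<ge>M. norm (X n - L) < e"
proof -
  have a: "Cauchy (\<lambda>n. alg_part (X n))"
    unfolding Cauchy_def dist_norm
  proof (intro allI impI)
    fix e :: real assume "0 < e"
    then obtain M where M: "\<forall>m\<ge>M. \<forall>n\<ge>M. norm (X m - X n) < e / 2" using C[of "e/2"] by auto
    have "norm (alg_part (X m) - alg_part (X n)) < e" if "m \<ge> M" "n \<ge> M" for m n
      using norm_alg_part_le[of "X m - X n"] M that
      by (fastforce simp: minus_unitization_def)
    then show "\<exists>M. \<forall>m\<ge>M. \<forall>n\<ge>M. norm (alg_part (X m) - alg_part (X n)) < e" by blast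
  qed
  have s: "Cauchy (\<lambda>n. scalar_part (X n))"
    unfolding Cauchy_def dist_norm
  proof (intro allI impI)
    fix e :: real assume "0 < e"
    then obtain M where M: "\<forall>m\<ge>M. \<forall>n\<ge>M. norm (X m - X n) < e" using C by blast
    then show "\<exists>M. \<forall>m\<ge>M. \<forall>n\<ge>M. norm (scalar_part (X m) - scalar_part (X n)) < e"
      by (intro exI[of _ M]) (auto simp: norm_unitization_def minus_unitization_def)
  qed
  obtain l where l: "(\<lambda>n. alg_part (X n)) \<longlonglongrightarrow> l"
    using a Cauchy_convergent_iff convergent_def by blast
  obtain k where k: "(\<lambda>n. scalar_part (X n)) \<longlonglongrightarrow> k"
    using s Cauchy_convergent_iff convergent_def by blast
  show ?thesis
  proof (rule exI[of _ "Unitization l k"], intro allI impI)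
    fix e :: real assume e: "0 < e"
    obtain M where M: "\<forall>n\<ge>M. norm (alg_part (X n) - l) < e / 2"
      using LIMSEQ_D[OF l, of "e/2"] e by auto
    obtain N where N: "\<forall>n\<ge>N. norm (scalar_part (X n) - k) < e / 2"
      using LIMSEQ_D[OF k, of "e/2"] e by auto
    have "norm (X n - Unitization l k) < e" if "n \<ge> max M N" for n
    proof -
      have "norm (alg_part (X n) - l) < e / 2" "norm (scalar_part (X n) - k) < e / 2"
        using M N that by auto
      then show ?thesis
        using norm_unitization_le[of "X n - Unitization l k"] by (simp add: minus_unitization_def)
    qed
    then show "\<exists>M. \<forall>n\<ge>M. norm (X n - Unitization l k) < e" by blast
  qed
qed

instance
proof
  fix u v w :: "'a unitization" and r :: real and c d :: complex
  show "norm (c *\<^sub>C u) = cmod c * norm u"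
    by (simp add: norm_unitization_def op_norm_scaleC scaleC_unitization_def norm_mult
        max_mult_distrib_left)
  show "complex_of_real r *\<^sub>C u = r *\<^sub>R u"
    by (simp add: unitization_ops' scaleC_of_real scaleR_conv_of_real)
  show "c *\<^sub>C (u + v) = c *\<^sub>C u + c *\<^sub>C v" "(c + d) *\<^sub>C u = c *\<^sub>C u + d *\<^sub>C u"
    "c *\<^sub>C d *\<^sub>C u = (c * d) *\<^sub>C u"
    by (simp_all add: unitization_ops' algebra_simps scaleC_add_right scaleC_add_left scaleC_scaleC)
  show "(c *\<^sub>C u) * v = c *\<^sub>C (u * v)" "u * (c *\<^sub>C v) = c *\<^sub>C (u * v)"
    by (simp_all add: unitization_ops' scaleC_add_right scaleC_scaleC scaleC_mult_left
        scaleC_mult_right mult_ac)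
  show "star (star u) = u" "star (u + v) = star u + star v" "star (c *\<^sub>C u) = cnj c *\<^sub>C star u"
    "star (u * v) = star v * star u"
    by (simp_all add: unitization_ops' star_star star_add star_scaleC star_mult add_ac)
  show "norm (star u * u) = (norm u)\<^sup>2"
  proof -
    have "cmod (scalar_part (star u * u)) = (cmod (scalar_part u))\<^sup>2"
      by (simp add: unitization_ops' norm_mult power2_eq_square)
    then show ?thesis
      by (auto simp: norm_unitization_def op_norm_star_mult max_def power_mono op_norm_nonneg
          dest: power2_le_imp_le)
  qed
next
  fix X :: "nat \<Rightarrow> 'a unitization" assume "Cauchy X"
  then show "convergent X"
    using unitization_Cauchy_converges[of X]
    unfolding Cauchy_def convergent_def LIMSEQ_def dist_norm by blast
qed

end

lemma norm_unitization_nonunital: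
  assumes nonunital: "\<not> unital TYPE('a::cstar_algebra)"
  shows "norm (u :: 'a unitization) = (SUP b\<in>{b. norm b \<le> 1}. norm (alg_part u * b + scalar_part u *\<^sub>C b))"
proof -
  have "cmod (scalar_part u) \<le> op_norm u"
  proof (rule ccontr)
    assume "\<not> cmod (scalar_part u) \<le> op_norm u"
    then have less: "op_norm u < cmod (scalar_part u)" by simp
    then have nz: "scalar_part u \<noteq> 0" using op_norm_nonneg[of u] by auto
    define k where "k = - inverse (scalar_part u)"
    define a where "a = k *\<^sub>C alg_part u"
    define r where "r = cmod k * op_norm u"
    have r: "0 \<le> r" "r < 1"
      using less nz op_norm_nonneg[of u] by (simp_all add: r_def k_def norm_inverse norm_divide field_simps)
    have contr: "norm (b - a * b) \<le> r * norm b" for b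
    proof -
      have "unit_act (Unitization (k *\<^sub>C alg_part u) (k * scalar_part u)) b = a * b - b"
        using nz by (simp add: unit_act_def a_def k_def scaleC_minus_left)
      then show ?thesis
        using op_norm_bound[of "Unitization (k *\<^sub>C alg_part u) (k * scalar_part u)" b]
        by (simp add: op_norm_scaleC r_def norm_minus_commute)
    qed
    have "\<exists>!e. a + e - a * e = e"
    proof (rule banach_fix_type[OF r], intro allI)
      show "dist (a + b - a * b) (a + c - a * c) \<le> r * dist b c" for b c
        using contr[of "b - c"] by (simp add: dist_norm right_diff_distrib algebra_simps)
    qed
    then obtain e where "a + e - a * e = e" by blast
    then have e: "a * e = a" by (simp add: algebra_simps)
    have left: "e * b = b" for b
    proof -
      have "a * (e * b - b) = 0" by (simp add: right_diff_distrib mult.assoc[symmetric] e)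
      then have "norm (e * b - b) \<le> r * norm (e * b - b)"
        using contr[of "e * b - b"] by simp
      then have "(1 - r) * norm (e * b - b) \<le> 0" by (simp add: algebra_simps)
      then show ?thesis using r by (simp add: mult_le_0_iff)
    qed
    have right: "b * star e = b" for b
      using left[of "star b"] by (metis star_mult star_star)
    have "star e = e" using left[of "star e"] right[of e] by simp
    then have "is_unit_element e" using left right by (simp add: is_unit_element_def)
    then show False using nonunital by (auto simp: unital_def)
  qed
  then show ?thesis by (simp add: norm_unitization_def op_norm_def unit_act_def)
qed

lemma is_unit_element_unitization: "is_unit_element (Unitization (0::'a::cstar_algebra) 1)"
  by (simp add: is_unit_element_def times_unitization_def)

lemma unital_unitization: "unital TYPE('a::cstar_algebra unitization)"
  unfolding unital_def using is_unit_element_unitization by blast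

definition unitization_embed :: "'a::cstar_algebra \<Rightarrow> 'a unitization" where
  "unitization_embed a = Unitization a 0"


section \<open>The universal representation and the enveloping von Neumann algebra\<close>

definition state :: "('b::cstar_algebra \<Rightarrow> complex) \<Rightarrow> bool" where
  "state \<phi> \<longleftrightarrow> bounded_linear \<phi> \<and> (\<forall>c a. \<phi> (c *\<^sub>C a) = c * \<phi> a)
     \<and> (\<forall>a. \<phi> (star a * a) \<in> \<real>\<^sub>\<ge>\<^sub>0) \<and> onorm \<phi> = 1"

text \<open>The Hilbert space of the GNS construction for \<open>\<phi>\<close> is the completion of the algebra in the
  semi-inner product \<open>\<phi> (star a * b)\<close>.  By the Riesz theorem this completion is the space of
  antilinear functionals that are bounded for the seminorm \<open>sqrt (\<phi> (star a * a))\<close>: the functional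
  \<open>\<xi>\<close> stands for the vector \<open>v\<close> with \<open>\<xi> a = \<langle>[a], v\<rangle>\<close>, so that the class \<open>[b]\<close> is
  \<open>\<lambda>a. \<phi> (star a * b)\<close>, and the norm of \<open>v\<close> is the norm of the functional.\<close>

definition gns_space :: "('b::cstar_algebra \<Rightarrow> complex) \<Rightarrow> ('b \<Rightarrow> complex) set" where
  "gns_space \<phi> = {\<xi>. (\<forall>a b. \<xi> (a + b) = \<xi> a + \<xi> b) \<and> (\<forall>c a. \<xi> (c *\<^sub>C a) = cnj c * \<xi> a)
     \<and> (\<exists>K. \<forall>a. (cmod (\<xi> a))\<^sup>2 \<le> K * Re (\<phi> (star a * a)))}"

definition gns_norm :: "('b::cstar_algebra \<Rightarrow> complex) \<Rightarrow> ('b \<Rightarrow> complex) \<Rightarrow> real" where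
  "gns_norm \<phi> \<xi> = (SUP a\<in>{a. Re (\<phi> (star a * a)) \<le> 1}. cmod (\<xi> a))"

text \<open>Polarization; inner products of vectors are antilinear in the first argument.\<close>

definition gns_inner ::
    "('b::cstar_algebra \<Rightarrow> complex) \<Rightarrow> ('b \<Rightarrow> complex) \<Rightarrow> ('b \<Rightarrow> complex) \<Rightarrow> complex" where
  "gns_inner \<phi> \<xi> \<eta> =
     (\<Sum>k<4. (- \<i>) ^ k * complex_of_real ((gns_norm \<phi> (\<lambda>a. \<xi> a + \<i> ^ k * \<eta> a))\<^sup>2)) / 4"

text \<open>The Hilbert direct sum of the GNS spaces over all states; a vector vanishes at non-states.\<close>

type_synonym 'b universal_vector = "('b \<Rightarrow> complex) \<Rightarrow> 'b \<Rightarrow> complex"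

definition universal_space :: "'b::cstar_algebra universal_vector set" where
  "universal_space = {\<xi>. (\<forall>\<phi>. state \<phi> \<longrightarrow> \<xi> \<phi> \<in> gns_space \<phi>)
     \<and> (\<forall>\<phi>. \<not> state \<phi> \<longrightarrow> \<xi> \<phi> = (\<lambda>a. 0))
     \<and> (\<lambda>\<phi>. (gns_norm \<phi> (\<xi> \<phi>))\<^sup>2) summable_on {\<phi>. state \<phi>}}"

definition universal_inner ::
    "'b::cstar_algebra universal_vector \<Rightarrow> 'b universal_vector \<Rightarrow> complex" where
  "universal_inner \<xi> \<eta> = (\<Sum>\<^sub>\<infinity>\<phi>\<in>{\<phi>. state \<phi>}. gns_inner \<phi> (\<xi> \<phi>) (\<eta> \<phi>))"

definition universal_norm :: "'b::cstar_algebra universal_vector \<Rightarrow> real" where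
  "universal_norm \<xi> = sqrt (Re (universal_inner \<xi> \<xi>))"

definition bounded_operator ::
    "('b::cstar_algebra universal_vector \<Rightarrow> 'b universal_vector) \<Rightarrow> bool" where
  "bounded_operator T \<longleftrightarrow> T \<in> extensional universal_space
     \<and> (\<forall>\<xi>\<in>universal_space. T \<xi> \<in> universal_space)
     \<and> (\<forall>\<xi>\<in>universal_space. \<forall>\<eta>\<in>universal_space.
           T (\<lambda>\<phi> a. \<xi> \<phi> a + \<eta> \<phi> a) = (\<lambda>\<phi> a. T \<xi> \<phi> a + T \<eta> \<phi> a))
     \<and> (\<forall>c. \<forall>\<xi>\<in>universal_space. T (\<lambda>\<phi> a. c * \<xi> \<phi> a) = (\<lambda>\<phi> a. c * T \<xi> \<phi> a))
     \<and> (\<exists>K. \<forall>\<xi>\<in>universal_space. universal_norm (T \<xi>) \<le> K * universal_norm \<xi>)"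

text \<open>Left multiplication on every summand: \<open>\<langle>[a], \<pi> b v\<rangle> = \<langle>[star b * a], v\<rangle>\<close>.\<close>

definition universal_rep ::
    "'b::cstar_algebra \<Rightarrow> 'b universal_vector \<Rightarrow> 'b universal_vector" where
  "universal_rep b = (\<lambda>\<xi>\<in>universal_space. \<lambda>\<phi> a. \<xi> \<phi> (star b * a))"

definition commutant ::
    "('b::cstar_algebra universal_vector \<Rightarrow> 'b universal_vector) set
      \<Rightarrow> ('b universal_vector \<Rightarrow> 'b universal_vector) set" where
  "commutant S =
     {T. bounded_operator T \<and> (\<forall>R\<in>S. \<forall>\<xi>\<in>universal_space. T (R \<xi>) = R (T \<xi>))}"

definition enveloping_vN ::
    "('b::cstar_algebra universal_vector \<Rightarrow> 'b universal_vector) set" where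
  "enveloping_vN = commutant (commutant (range universal_rep))"

definition operator_le ::
    "('b::cstar_algebra universal_vector \<Rightarrow> 'b universal_vector)
      \<Rightarrow> ('b universal_vector \<Rightarrow> 'b universal_vector) \<Rightarrow> bool" where
  "operator_le S T \<longleftrightarrow>
     (\<forall>\<xi>\<in>universal_space. universal_inner \<xi> (T \<xi>) - universal_inner \<xi> (S \<xi>) \<in> \<real>\<^sub>\<ge>\<^sub>0)"

definition square_summable :: "(nat \<Rightarrow> 'b::cstar_algebra universal_vector) \<Rightarrow> bool" where
  "square_summable \<xi> \<longleftrightarrow>
     (\<forall>n. \<xi> n \<in> universal_space) \<and> summable (\<lambda>n. (universal_norm (\<xi> n))\<^sup>2)"

definition ultraweak_functionals ::
    "(('b::cstar_algebra universal_vector \<Rightarrow> 'b universal_vector) \<Rightarrow> complex) set" where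
  "ultraweak_functionals =
     {\<lambda>T. \<Sum>n. universal_inner (\<xi> n) (T (\<eta> n)) |\<xi> \<eta>. square_summable \<xi> \<and> square_summable \<eta>}"

definition ultraweak_topology ::
    "('b::cstar_algebra universal_vector \<Rightarrow> 'b universal_vector) topology" where
  "ultraweak_topology = topology_generated_by
     {{T \<in> enveloping_vN. \<omega> T \<in> U} |\<omega> U. \<omega> \<in> ultraweak_functionals \<and> open U}"


section \<open>Hilbert C*-modules and frames\<close>

text \<open>Multiplication of module elements by complex scalars is the action of the multiples of the
  unit of the coefficient algebra.\<close>

locale hilbert_cstar_module =
  fixes act :: "'n::ab_group_add \<Rightarrow> 'b::cstar_algebra \<Rightarrow> 'n"
    and ip :: "'n \<Rightarrow> 'n \<Rightarrow> 'b"
  assumes coefficients_unital: "unital TYPE('b)"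
    and act_unit: "is_unit_element e \<Longrightarrow> act x e = x"
    and act_add_left: "act (x + y) b = act x b + act y b"
    and act_add_right: "act x (b + c) = act x b + act x c"
    and act_mult: "act x (b * c) = act (act x b) c"
    and ip_add_right: "ip x (y + z) = ip x y + ip x z"
    and ip_act_right: "ip x (act y b) = ip x y * b"
    and ip_star: "star (ip x y) = ip y x"
    and ip_positive: "\<exists>c. ip x x = star c * c"
    and ip_definite: "ip x x = 0 \<Longrightarrow> x = 0"
    and module_complete:
      "(\<And>\<epsilon>. \<epsilon> > 0 \<Longrightarrow> \<exists>N. \<forall>m\<ge>N. \<forall>n\<ge>N. sqrt (norm (ip (X m - X n) (X m - X n))) < \<epsilon>)
        \<Longrightarrow> \<exists>x. (\<lambda>n. sqrt (norm (ip (X n - x) (X n - x)))) \<longlonglongrightarrow> 0"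
begin

text \<open>The non-standard frames, i.e. frames in the weakest sense: a norm convergent series converges
  ultraweakly to the same sum, so every standard frame is one of these.\<close>

definition frame :: "('j \<Rightarrow> 'n) \<Rightarrow> 'j set \<Rightarrow> bool" where
  "frame x J \<longleftrightarrow> (\<exists>c1>0. \<exists>c2>0. \<forall>y. \<exists>T.
     limitin ultraweak_topology (\<lambda>F. universal_rep (\<Sum>j\<in>F. ip y (x j) * ip (x j) y)) T
       (finite_subsets_at_top J)
     \<and> operator_le (universal_rep (c1 *\<^sub>R ip y y)) T
     \<and> operator_le T (universal_rep (c2 *\<^sub>R ip y y)))"

end

lemma cstar_algebra_module_complete:
  fixes X :: "nat \<Rightarrow> 'a::cstar_algebra"
  assumes "\<And>\<epsilon>. \<epsilon> > 0 \<Longrightarrow> \<exists>N. \<forall>m\<ge>N. \<forall>n\<ge>N. norm (X m - X n) < \<epsilon>"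
  shows "\<exists>x. (\<lambda>n. norm (X n - x)) \<longlonglongrightarrow> 0"
proof -
  have "Cauchy X" using assms by (auto simp: Cauchy_def dist_norm)
  then obtain x where "X \<longlonglongrightarrow> x" using Cauchy_convergent_iff convergent_def by blast
  then have "(\<lambda>n. norm (X n - x)) \<longlonglongrightarrow> 0"
    by (intro tendsto_norm_zero LIM_zero)
  then show ?thesis by blast
qed

lemma star_mult_self_eq_0: "star a * a = 0 \<Longrightarrow> (a::'a::cstar_algebra) = 0"
  using cstar_identity[of a] by simp

definition self_act :: "'a::cstar_algebra \<Rightarrow> 'a \<Rightarrow> 'a" where
  "self_act a b = a * b"

definition self_ip :: "'a::cstar_algebra \<Rightarrow> 'a \<Rightarrow> 'a" where
  "self_ip a b = star a * b"

definition unitization_act :: "'a::cstar_algebra \<Rightarrow> 'a unitization \<Rightarrow> 'a" where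
  "unitization_act a u = a * alg_part u + scalar_part u *\<^sub>C a"

definition unitization_ip :: "'a::cstar_algebra \<Rightarrow> 'a \<Rightarrow> 'a unitization" where
  "unitization_ip a b = unitization_embed (star a * b)"

lemma unitization_act_embed:
  "unitization_embed (unitization_act a u) = unitization_embed a * u"
  by (simp add: unitization_embed_def unitization_act_def times_unitization_def)

lemma hilbert_cstar_module_self:
  assumes "unital TYPE('a::cstar_algebra)"
  shows "hilbert_cstar_module (self_act :: 'a \<Rightarrow> _) self_ip"
proof
  fix X :: "nat \<Rightarrow> 'a"
  assume "\<exists>N. \<forall>m\<ge>N. \<forall>n\<ge>N. sqrt (norm (self_ip (X m - X n) (X m - X n))) < \<epsilon>" if "\<epsilon> > 0" for \<epsilon>
  then show "\<exists>x. (\<lambda>n. sqrt (norm (self_ip (X n - x) (X n - x)))) \<longlonglongrightarrow> 0"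
    by (simp add: self_ip_def cstar_identity cstar_algebra_module_complete)
qed (auto simp: assms self_act_def self_ip_def is_unit_element_def distrib_left distrib_right
      mult.assoc star_mult star_star dest: star_mult_self_eq_0)

lemma hilbert_cstar_module_unitization:
  "hilbert_cstar_module (unitization_act :: 'a::cstar_algebra \<Rightarrow> _) unitization_ip"
proof
  fix X :: "nat \<Rightarrow> 'a"
  have eq: "sqrt (norm (unitization_ip a a)) = norm a" for a :: 'a
    by (simp add: unitization_ip_def unitization_embed_def norm_unitization_def op_norm_alg
        cstar_identity)
  assume "\<exists>N. \<forall>m\<ge>N. \<forall>n\<ge>N. sqrt (norm (unitization_ip (X m - X n) (X m - X n))) < \<epsilon>"
    if "\<epsilon> > 0" for \<epsilon>
  then show "\<exists>x. (\<lambda>n. sqrt (norm (unitization_ip (X n - x) (X n - x)))) \<longlonglongrightarrow> 0"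
    by (simp add: eq cstar_algebra_module_complete)
next
  fix e :: "'a unitization" and x :: 'a
  assume "is_unit_element e"
  then have "e = Unitization 0 1"
    using is_unit_element_unitization unfolding is_unit_element_def by metis
  then show "unitization_act x e = x" by (simp add: unitization_act_def)
next
  fix x :: 'a
  show "\<exists>c. unitization_ip x x = star c * c"
    by (rule exI[of _ "unitization_embed x"])
       (simp add: unitization_ip_def unitization_embed_def star_unitization_def times_unitization_def)
next
  fix x :: 'a assume "unitization_ip x x = 0"
  then have "star x * x = 0"
    by (simp add: unitization_ip_def unitization_embed_def zero_unitization_def)
  then show "x = 0" by (rule star_mult_self_eq_0)
qed (simp_all add: unital_unitization unitization_act_def unitization_ip_def unitization_embed_def
      plus_unitization_def times_unitization_def star_unitization_def distrib_left distrib_right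
      scaleC_add_left scaleC_add_right scaleC_scaleC scaleC_mult_left scaleC_mult_right mult.assoc
      star_mult star_star mult.commute[of "_::complex"])

text \<open>The algebra is a Hilbert module over its unitalization, which is the algebra itself if it is
  unital; the interpretations of the module locale are \<open>hilbert_cstar_module_self\<close> and
  \<open>hilbert_cstar_module_unitization\<close>.\<close>

definition algebra_frame :: "('j \<Rightarrow> 'a::cstar_algebra) \<Rightarrow> 'j set \<Rightarrow> bool" where
  "algebra_frame x J \<longleftrightarrow>
     (if unital TYPE('a) then hilbert_cstar_module.frame (self_ip :: 'a \<Rightarrow> 'a \<Rightarrow> 'a) x J
      else hilbert_cstar_module.frame (unitization_ip :: 'a \<Rightarrow> 'a \<Rightarrow> 'a unitization) x J)"

end

theory Submission
  imports Defs
begin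

text \<open>Write \<open>S\<close> for the partial sum of \<open>x\<^sub>j x\<^sub>j\<^sup>*\<close> over a finite set \<open>F\<close>, and \<open>c\<close> for an upper frame
  bound.  The frame inequality for a module element \<open>y\<close> bounds the partial sums \<open>y\<^sup>* S y\<close> of its
  series by \<open>c y\<^sup>* y\<close> in every state.  Taking \<open>y = S\<close> gives \<open>\<phi> (S\<^sup>3) \<le> c \<phi> (S\<^sup>2)\<close> for all states
  \<open>\<phi>\<close>.  If \<open>\<phi>\<close> is a state with \<open>\<phi> (S\<^sup>2) = \<parallel>S\<parallel>\<^sup>2\<close> and \<open>t = \<parallel>S\<parallel>\<close>, then \<open>\<phi> ((t - S) S (t - S)) \<ge> 0\<close> yields
  \<open>\<phi> (S\<^sup>3) \<ge> t\<^sup>3\<close>, hence \<open>\<parallel>S\<parallel> \<le> c\<close> for every \<open>F\<close> (lemma \<open>norm_sum_mult_star_le\<close>).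

  Two ingredients are needed: enough states, and a way from ultraweak convergence to states.

  States are produced without spectral theory.  For commuting self-adjoint \<open>b\<close>, \<open>c\<close> the C*-identity
  gives \<open>\<parallel>b\<parallel>\<^sup>2 \<le> \<parallel>b\<^sup>2 + c\<^sup>2\<parallel>\<close>.  Applied to two polynomial identities it shows that
  \<open>\<parallel>\<parallel>b\<parallel>\<^sup>2 + b\<^sup>2\<parallel> = 2 \<parallel>b\<parallel>\<^sup>2\<close>, so that by the Hahn-Banach theorem some real functional \<open>f\<close> of norm one
  with \<open>f 1 = 1\<close> attains \<open>\<parallel>b\<parallel>\<^sup>2\<close> at \<open>b\<^sup>2\<close>, and that all such functionals are nonnegative at squares of
  self-adjoint elements.  Positivity at \<open>c\<^sup>* c\<close> for arbitrary \<open>c\<close> is the substantial point (the theorem of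
  Fukamiya and Kaplansky); it amounts to \<open>\<parallel>1 - c\<^sup>* c\<parallel> \<le> 1\<close> for \<open>\<parallel>c\<parallel> \<le> 1\<close>.  Put \<open>z = 1 - c\<^sup>* c\<close> and
  \<open>d = c z\<^sup>n\<close>.  Both \<open>d\<^sup>* d\<close> and \<open>d d\<^sup>*\<close> are at most \<open>1\<close>, and their sum is twice the sum of the squares
  of the real and imaginary parts of \<open>d\<close>, so \<open>\<parallel>d\<parallel> \<le> 2\<close>.  Therefore \<open>z\<^sup>n - z\<^sup>n\<^sup>+\<^sup>1 = c\<^sup>* d\<close> is bounded
  and \<open>\<parallel>z\<^sup>n\<parallel>\<close> grows at most linearly.  But \<open>\<parallel>z\<^sup>n\<parallel> = \<parallel>z\<parallel>\<^sup>n\<close> when \<open>n\<close> is a power of \<open>2\<close>, which forces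
  \<open>\<parallel>z\<parallel> \<le> 1\<close>.

  For the second ingredient, the cyclic GNS vector of a state \<open>\<phi>\<close>, placed in the summand of \<open>\<phi>\<close> of the
  universal representation, has \<open>\<phi>\<close> as its vector functional.  This functional is ultraweakly
  continuous, and the partial sums increase in every state, so each of them obeys the bound that
  holds for the ultraweak limit (lemma \<open>state_partial_sum_le\<close>).\<close>


section \<open>Norming functionals\<close>

definition sublinear :: "('v::real_vector \<Rightarrow> real) \<Rightarrow> bool" where
  "sublinear q \<longleftrightarrow> (\<forall>x y. q (x + y) \<le> q x + q y) \<and> (\<forall>c\<ge>0. \<forall>x. q (c *\<^sub>R x) = c * q x)"

text \<open>In the homogeneity law one inequality is enough: apply it to the inverse scalar.\<close>

lemma sublinearI:
  assumes add: "\<And>x y. q (x + y) \<le> q x + q y"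
    and scale: "\<And>c x. 0 < c \<Longrightarrow> q (c *\<^sub>R x) \<le> c * q x"
    and zero: "q 0 = 0"
  shows "sublinear q"
  unfolding sublinear_def
proof (intro conjI allI impI add)
  fix c :: real and x assume "0 \<le> c"
  show "q (c *\<^sub>R x) = c * q x"
  proof (cases "c = 0")
    case False
    with \<open>0 \<le> c\<close> have c: "0 < c" by simp
    have "q x \<le> inverse c * q (c *\<^sub>R x)"
      using scale[of "inverse c" "c *\<^sub>R x"] c by simp
    then have "c * q x \<le> q (c *\<^sub>R x)" using c by (simp add: field_simps)
    with scale[OF c, of x] show ?thesis by simp
  qed (simp add: zero)
qed

lemma sublinear_zero: "sublinear q \<Longrightarrow> q 0 = 0"
  unfolding sublinear_def by (metis mult_zero_left order_refl scaleR_zero_left)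

lemma sublinear_minus: "sublinear q \<Longrightarrow> - q (- x) \<le> q x"
  using sublinear_zero[of q] unfolding sublinear_def
  by (metis add.right_inverse add_le_cancel_right diff_0 diff_le_eq)

lemma sublinear_norm: "sublinear (norm :: 'v::real_normed_vector \<Rightarrow> real)"
  by (simp add: sublinear_def norm_triangle_ineq)

text \<open>The largest sublinear functional below \<open>q\<close> whose value at \<open>- y\<close> is as small as
  linearity allows, namely \<open>- q y\<close>.\<close>

definition linearize_at :: "('v::real_vector \<Rightarrow> real) \<Rightarrow> 'v \<Rightarrow> 'v \<Rightarrow> real" where
  "linearize_at q y x = (INF t\<in>{0..}. q (x + t *\<^sub>R y) - t * q y)"

lemma linearize_at_bdd:
  assumes "sublinear q"
  shows "bdd_below ((\<lambda>t. q (x + t *\<^sub>R y) - t * q y) ` {0..})"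
proof (rule bdd_belowI2)
  fix t :: real assume "t \<in> {0..}"
  then have "t * q y = q ((x + t *\<^sub>R y) + (- x))" using assms by (simp add: sublinear_def)
  also have "\<dots> \<le> q (x + t *\<^sub>R y) + q (- x)" using assms unfolding sublinear_def by blast
  finally show "- q (- x) \<le> q (x + t *\<^sub>R y) - t * q y" by simp
qed

lemma linearize_at_le:
  "sublinear q \<Longrightarrow> 0 \<le> t \<Longrightarrow> linearize_at q y x \<le> q (x + t *\<^sub>R y) - t * q y"
  unfolding linearize_at_def by (rule cINF_lower[OF linearize_at_bdd]) auto

lemma le_linearize_at:
  "(\<And>t. 0 \<le> t \<Longrightarrow> K \<le> q (x + t *\<^sub>R y) - t * q y) \<Longrightarrow> K \<le> linearize_at q y x"
  unfolding linearize_at_def by (rule cINF_greatest) auto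

lemma sublinear_linearize_at:
  assumes q: "sublinear q"
  shows "sublinear (linearize_at q y)"
proof (rule sublinearI)
  fix x x'
  have "linearize_at q y (x + x') - linearize_at q y x' \<le> linearize_at q y x"
  proof (rule le_linearize_at)
    fix t :: real assume t: "0 \<le> t"
    have "linearize_at q y (x + x') - (q (x + t *\<^sub>R y) - t * q y) \<le> linearize_at q y x'"
    proof (rule le_linearize_at)
      fix s :: real assume s: "0 \<le> s"
      have "linearize_at q y (x + x') \<le> q ((x + x') + (t + s) *\<^sub>R y) - (t + s) * q y"
        by (rule linearize_at_le[OF q]) (use t s in simp)
      also have "(x + x') + (t + s) *\<^sub>R y = (x + t *\<^sub>R y) + (x' + s *\<^sub>R y)"
        by (simp add: algebra_simps)
      also have "q \<dots> \<le> q (x + t *\<^sub>R y) + q (x' + s *\<^sub>R y)"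
        using q unfolding sublinear_def by blast
      finally show "linearize_at q y (x + x') - (q (x + t *\<^sub>R y) - t * q y)
          \<le> q (x' + s *\<^sub>R y) - s * q y"
        by (simp add: algebra_simps)
    qed
    then show "linearize_at q y (x + x') - linearize_at q y x' \<le> q (x + t *\<^sub>R y) - t * q y"
      by simp
  qed
  then show "linearize_at q y (x + x') \<le> linearize_at q y x + linearize_at q y x'" by simp
next
  fix c :: real and x assume c: "0 < c"
  have "linearize_at q y (c *\<^sub>R x) / c \<le> linearize_at q y x"
  proof (rule le_linearize_at)
    fix t :: real assume t: "0 \<le> t"
    have "linearize_at q y (c *\<^sub>R x) \<le> q (c *\<^sub>R x + (c * t) *\<^sub>R y) - (c * t) * q y"
      by (rule linearize_at_le[OF q]) (use c t in simp)
    also have "q (c *\<^sub>R x + (c * t) *\<^sub>R y) = c * q (x + t *\<^sub>R y)"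
      using q c unfolding sublinear_def
      by (metis less_imp_le scaleR_add_right scaleR_scaleR)
    finally show "linearize_at q y (c *\<^sub>R x) / c \<le> q (x + t *\<^sub>R y) - t * q y"
      using c by (simp add: field_simps)
  qed
  then show "linearize_at q y (c *\<^sub>R x) \<le> c * linearize_at q y x"
    using c by (simp add: field_simps)
next
  show "linearize_at q y 0 = 0"
  proof (rule antisym)
    show "linearize_at q y 0 \<le> 0"
      using linearize_at_le[OF q order_refl, of y 0] sublinear_zero[OF q] by simp
    show "0 \<le> linearize_at q y 0"
      by (rule le_linearize_at) (use q in \<open>simp add: sublinear_def\<close>)
  qed
qed

text \<open>A minimal sublinear functional \<open>m\<close> equals \<open>linearize_at m y\<close> for every \<open>y\<close>; this gives the
  missing inequality \<open>m x + m y \<le> m (x + y)\<close>.\<close>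

lemma minimal_sublinear_linear:
  assumes m: "sublinear m"
    and minimal: "\<And>q. sublinear q \<Longrightarrow> (\<And>x. q x \<le> m x) \<Longrightarrow> q = m"
  shows "linear m"
proof -
  have add: "m (x + y) = m x + m y" for x y
  proof (rule antisym)
    have "linearize_at m y = m"
    proof (rule minimal)
      show "linearize_at m y x \<le> m x" for x
        using linearize_at_le[OF m order_refl, of y x] by simp
    qed (rule sublinear_linearize_at[OF m])
    then show "m x + m y \<le> m (x + y)" using linearize_at_le[OF m, of 1 y x] by simp
  qed (use m in \<open>simp add: sublinear_def\<close>)
  have minus: "m (- x) = - m x" for x
    using add[of x "- x"] sublinear_zero[OF m] by simp
  show ?thesis
  proof (rule linearI)
    show "m (x + y) = m x + m y" for x y by (rule add)
    show "m (c *\<^sub>R x) = c *\<^sub>R m x" for c x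
    proof (cases "0 \<le> c")
      case True
      then show ?thesis using m by (simp add: sublinear_def)
    next
      case False
      then have "m ((- c) *\<^sub>R x) = (- c) * m x" 
        using m[unfolded sublinear_def, THEN conjunct2, rule_format, of "- c" x] by simp
      then show ?thesis using minus[of "c *\<^sub>R x"] by simp
    qed
  qed
qed

text \<open>The infimum of a chain of sublinear functionals is sublinear, so Zorn's lemma provides a
  minimal one.\<close>

lemma linear_below_sublinear:
  assumes q0: "sublinear (q0 :: 'v::real_vector \<Rightarrow> real)"
  obtains f where "linear f" "\<And>x. f x \<le> q0 x"
proof -
  define A where "A = {q. sublinear q \<and> (\<forall>x. q x \<le> q0 x)}"
  let ?P = "\<lambda>p q :: 'v \<Rightarrow> real. \<forall>x. q x \<le> p x"
  have "\<exists>m\<in>A. \<forall>a\<in>A. ?P m a \<longrightarrow> a = m"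
  proof (rule predicate_Zorn)
    show "partial_order_on A (relation_of ?P A)"
      unfolding partial_order_on_def preorder_on_def
      by (auto simp: relation_of_def refl_on_def trans_def antisym_def fun_eq_iff
          intro: order_trans antisym)
  next
    fix C assume C: "C \<in> Chains (relation_of ?P A)"
    then have CA: "C \<subseteq> A" by (auto simp: Chains_def relation_of_def)
    show "\<exists>u\<in>A. \<forall>a\<in>C. ?P a u"
    proof (cases "C = {}")
      case True
      then show ?thesis using q0 by (auto simp: A_def)
    next
      case False
      define u where "u x = (INF q\<in>C. q x)" for x
      have sub: "sublinear q" and le: "q x \<le> q0 x" if "q \<in> C" for q x
        using that CA by (auto simp: A_def)
      have bdd: "bdd_below ((\<lambda>q. q x) ` C)" for x
      proof (rule bdd_belowI2)
        fix q assume "q \<in> C"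
        then show "- q0 (- x) \<le> q x" using sublinear_minus[OF sub, of q x] le[of q "- x"] by simp
      qed
      have u_le: "u x \<le> q x" if "q \<in> C" for q x
        unfolding u_def by (rule cINF_lower[OF bdd that])
      have le_u: "K \<le> u x" if "\<And>q. q \<in> C \<Longrightarrow> K \<le> q x" for K x
        unfolding u_def by (rule cINF_greatest[OF False that])
      have "sublinear u"
      proof (rule sublinearI)
        fix x y
        have "u (x + y) - u y \<le> u x"
        proof (rule le_u)
          fix p assume p: "p \<in> C"
          have "u (x + y) - p x \<le> u y"
          proof (rule le_u)
            fix q assume q: "q \<in> C"
            \<comment> \<open>the smaller of two members of the chain serves for both arguments\<close>
            obtain r where r: "r \<in> C" "\<forall>z. r z \<le> p z" "\<forall>z. r z \<le> q z"
              using C p q unfolding Chains_def relation_of_def by blast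
            have "u (x + y) \<le> r (x + y)" by (rule u_le[OF r(1)])
            also have "\<dots> \<le> r x + r y" using sub[OF r(1)] unfolding sublinear_def by blast
            also have "\<dots> \<le> p x + q y" using r by (intro add_mono) auto
            finally show "u (x + y) - p x \<le> q y" by simp
          qed
          then show "u (x + y) - u y \<le> p x" by simp
        qed
        then show "u (x + y) \<le> u x + u y" by simp
      next
        fix c :: real and x assume c: "0 < c"
        have "u (c *\<^sub>R x) / c \<le> u x"
        proof (rule le_u)
          fix q assume q: "q \<in> C"
          have "u (c *\<^sub>R x) \<le> c * q x"
            using u_le[OF q, of "c *\<^sub>R x"] sub[OF q] c by (simp add: sublinear_def)
          then show "u (c *\<^sub>R x) / c \<le> q x" using c by (simp add: field_simps)
        qed
        then show "u (c *\<^sub>R x) \<le> c * u x" using c by (simp add: field_simps)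
      next
        obtain q where "q \<in> C" using False by blast
        then show "u 0 = 0"
          using u_le[of q 0] le_u[of 0 0] sublinear_zero[OF sub] by force
      qed
      moreover have "u x \<le> q0 x" for x
        using False u_le le by (meson all_not_in_conv order_trans)
      ultimately show ?thesis using u_le by (auto simp: A_def)
    qed
  qed
  then obtain m where m: "m \<in> A" "\<And>a. a \<in> A \<Longrightarrow> (\<And>x. a x \<le> m x) \<Longrightarrow> a = m" by blast
  have "linear m"
  proof (rule minimal_sublinear_linear)
    show "sublinear m" using m(1) by (simp add: A_def)
    show "q = m" if "sublinear q" "\<And>x. q x \<le> m x" for q
    proof (rule m(2))
      show "q \<in> A" using that m(1) by (auto simp: A_def intro: order_trans)
    qed (rule that(2))
  qed
  with m(1) show ?thesis using that by (auto simp: A_def)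
qed

text \<open>A linear functional below \<open>linearize_at norm x0\<close> has the value \<open>- norm x0\<close> or less at \<open>- x0\<close>.\<close>

lemma norming_functional:
  fixes x0 :: "'v::real_normed_vector"
  obtains f where "linear f" "\<And>x. f x \<le> norm x" "f x0 = norm x0"
proof -
  have s: "sublinear (linearize_at norm x0)"
    by (rule sublinear_linearize_at[OF sublinear_norm])
  obtain f where f: "linear f" "\<And>x. f x \<le> linearize_at norm x0 x"
    using linear_below_sublinear[OF s] by blast
  have le: "f x \<le> norm x" for x
    using f(2)[of x] linearize_at_le[OF sublinear_norm order_refl, of x0 x] by simp
  have "f (- x0) \<le> - norm x0"
    using f(2)[of "- x0"] linearize_at_le[OF sublinear_norm, of 1 x0 "- x0"] by simp
  then have "f x0 = norm x0" using le[of x0] linear_neg[OF f(1), of x0] by simp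
  with f(1) le show ?thesis by (rule that)
qed


section \<open>Self-adjoint elements and the C*-identity\<close>

lemma star_minus: "star (- a) = - star (a::'a::cstar_algebra)"
  using star_add[of a "- a"] by (simp add: eq_neg_iff_add_eq_0 add.commute)

lemma star_diff: "star (a - b) = star a - star (b::'a::cstar_algebra)"
  using star_add[of a "- b"] by (simp add: star_minus)

lemma star_scaleR: "star (r *\<^sub>R a) = r *\<^sub>R star (a::'a::cstar_algebra)"
  using star_scaleC[of "complex_of_real r" a] by (simp add: scaleC_of_real)

lemma star_sum: "star (\<Sum>i\<in>I. f i) = (\<Sum>i\<in>I. star (f i :: 'a::cstar_algebra))"
  by (induction I rule: infinite_finite_induct) (simp_all add: star_add)

lemma scaleC_scaleR: "c *\<^sub>C (r *\<^sub>R a) = r *\<^sub>R (c *\<^sub>C (a::'a::cstar_algebra))"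
  by (simp add: scaleC_of_real[symmetric] scaleC_scaleC mult.commute)

lemmas cstar_simps = star_star star_add star_mult star_minus star_diff star_scaleR star_scaleC
  scaleC_add_right scaleC_diff_right scaleC_minus_left scaleC_minus_right scaleC_scaleC
  scaleC_mult_left scaleC_mult_right scaleC_scaleR

definition real_part :: "'a::cstar_algebra \<Rightarrow> 'a" where
  "real_part a = (1/2) *\<^sub>R (a + star a)"

lemma norm_real_part: "norm (real_part a) \<le> norm a"
  using norm_triangle_ineq[of a "star a"] by (simp add: real_part_def)

lemma star_real_part [simp]: "star (real_part a) = real_part a"
  by (simp add: real_part_def cstar_simps add.commute)

lemma real_part_add: "real_part (a + b) = real_part a + real_part b"
  by (simp add: real_part_def cstar_simps algebra_simps)

lemma real_part_scaleR: "real_part (r *\<^sub>R a) = r *\<^sub>R real_part a"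
  by (simp add: real_part_def cstar_simps algebra_simps)

lemma real_part_self_adjoint: "star a = a \<Longrightarrow> real_part a = a"
  by (simp add: real_part_def scaleR_2[symmetric])

lemma real_part_ii_self_adjoint: "star a = a \<Longrightarrow> real_part (\<i> *\<^sub>C a) = 0"
  by (simp add: real_part_def cstar_simps)

lemma cartesian: "a = real_part a - \<i> *\<^sub>C real_part (\<i> *\<^sub>C a)"
proof -
  have "real_part a - \<i> *\<^sub>C real_part (\<i> *\<^sub>C a) = (1/2) *\<^sub>R (a + star a) + (1/2) *\<^sub>R (a - star a)"
    by (simp add: real_part_def cstar_simps algebra_simps)
  also have "\<dots> = (1/2) *\<^sub>R a + (1/2) *\<^sub>R a" by (simp add: algebra_simps)
  also have "\<dots> = a" by (simp add: scaleR_left.add[symmetric])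
  finally show ?thesis by simp
qed

lemma star_mult_add_mult_star:
  fixes a :: "'a::cstar_algebra"
  defines "h \<equiv> real_part a" and "k \<equiv> real_part (\<i> *\<^sub>C a)"
  shows "star a * a + a * star a = 2 *\<^sub>R (h * h) + 2 *\<^sub>R (k * k)"
proof -
  have a: "a = h - \<i> *\<^sub>C k" unfolding h_def k_def by (rule cartesian)
  have sa: "star h = h" "star k = k" by (simp_all add: h_def k_def)
  show ?thesis
    unfolding a by (simp add: sa cstar_simps algebra_simps scaleR_2)
qed

text \<open>For commuting self-adjoint \<open>b\<close> and \<open>c\<close> the sum is \<open>star d * d\<close> with \<open>d = b + \<i> c\<close>, and
  \<open>b\<close> is the real part of \<open>d\<close>.\<close>

lemma norm_square_le_sum_squares:
  fixes b c :: "'a::cstar_algebra"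
  assumes b: "star b = b" and c: "star c = c" and comm: "b * c = c * b"
  shows "(norm b)\<^sup>2 \<le> norm (b * b + c * c)"
proof -
  define d where "d = b + \<i> *\<^sub>C c"
  have "real_part d = b"
    by (simp add: d_def real_part_add real_part_self_adjoint b real_part_ii_self_adjoint c)
  then have "(norm b)\<^sup>2 \<le> (norm d)\<^sup>2" using norm_real_part[of d] by simp
  moreover have "star d * d = b * b + c * c"
    by (simp add: d_def cstar_simps b c comm algebra_simps)
  ultimately show ?thesis using cstar_identity[of d] by simp
qed

lemma norm_self_adjoint_square: "star b = b \<Longrightarrow> norm (b * b) = (norm (b::'a::cstar_algebra))\<^sup>2"
  using cstar_identity[of b] by simp


section \<open>Real states\<close>

locale unital_cstar_algebra =
  fixes e :: "'b::cstar_algebra"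
  assumes unit: "is_unit_element e"
begin

lemma unit_simps [simp]: "e * a = a" "a * e = a"
  using unit by (simp_all add: is_unit_element_def)

lemma star_unit [simp]: "star e = e"
  by (metis star_mult star_star unit_simps(1))

lemma norm_unit: "b \<noteq> (0::'b) \<Longrightarrow> norm e = 1"
proof -
  assume "b \<noteq> 0"
  then have "e \<noteq> 0" by (metis mult_zero_left unit_simps(1))
  moreover have "norm e = norm e * norm e"
    using cstar_identity[of e] by (simp add: power2_eq_square)
  ultimately show ?thesis by simp
qed

lemma norm_unit_le: "norm e \<le> 1"
  using norm_unit[of e] by (cases "e = 0") auto

text \<open>The real parts of states: norm one and the value one at the unit imply positivity, see
  \<open>real_state_star_mult_nonneg\<close>.\<close>

definition real_state :: "('b \<Rightarrow> real) \<Rightarrow> bool" where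
  "real_state f \<longleftrightarrow> linear f \<and> (\<forall>a. f a \<le> norm a) \<and> f e = 1"

lemma real_stateD:
  assumes "real_state f"
  shows "f a \<le> norm a" "f e = 1" "f (a + b) = f a + f b" "f (a - b) = f a - f b"
    "f (r *\<^sub>R a) = r * f a" "f 0 = 0"
proof -
  have f: "linear f" "\<And>a. f a \<le> norm a" "f e = 1" using assms by (auto simp: real_state_def)
  show "f a \<le> norm a" "f e = 1" by (rule f)+
  show "f (a + b) = f a + f b" "f (a - b) = f a - f b" "f (r *\<^sub>R a) = r * f a" "f 0 = 0"
    using linear_add[OF f(1)] linear_diff[OF f(1)] linear_scale[OF f(1)] linear_0[OF f(1)]
    by auto
qed

text \<open>With \<open>T = \<parallel>b\<parallel>\<^sup>2\<close> the identity \<open>(T + b\<^sup>2)\<^sup>2 = (T - b\<^sup>2)\<^sup>2 + 4 T b\<^sup>2\<close> gives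
  \<open>\<parallel>T + b\<^sup>2\<parallel> = 2 T\<close>.  A functional of norm one that attains this norm must attain \<open>1\<close> at the
  unit and \<open>T\<close> at \<open>b\<^sup>2\<close>.\<close>

lemma real_state_attains_norm_square:
  assumes b: "star b = b" "b \<noteq> 0"
  obtains f where "real_state f" "f (b * b) = (norm b)\<^sup>2"
proof -
  define T where "T = (norm b)\<^sup>2"
  have T: "T > 0" using b by (simp add: T_def)
  define u where "u = T *\<^sub>R e + b * b"
  define v where "v = T *\<^sub>R e - b * b"
  define w where "w = (2 * norm b) *\<^sub>R b"
  have sa: "star u = u" "star v = v" "star w = w"
    by (simp_all add: u_def v_def w_def cstar_simps b)
  have "4 * T\<^sup>2 = (norm w)\<^sup>2" by (simp add: w_def T_def power2_eq_square)
  also have "\<dots> \<le> norm (w * w + v * v)"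
    by (rule norm_square_le_sum_squares[OF sa(3,2)]) (simp add: w_def v_def algebra_simps)
  also have "w * w + v * v = u * u"
  proof -
    have "w * w = (4 * T) *\<^sub>R (b * b)" by (simp add: w_def T_def power2_eq_square)
    also have "\<dots> = T *\<^sub>R (b * b) + T *\<^sub>R (b * b) + (T *\<^sub>R (b * b) + T *\<^sub>R (b * b))"
      by (simp flip: scaleR_left.add)
    finally show ?thesis by (simp add: u_def v_def algebra_simps)
  qed
  also have "norm (u * u) = (norm u)\<^sup>2" by (rule norm_self_adjoint_square[OF sa(1)])
  finally have "(2 * T)\<^sup>2 \<le> (norm u)\<^sup>2" by (simp add: power_mult_distrib)
  then have nu: "2 * T \<le> norm u" by (rule power2_le_imp_le) simp
  obtain f where f: "linear f" "\<And>a. f a \<le> norm a" "f u = norm u"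
    using norming_functional[of u] by blast
  have "f u = T * f e + f (b * b)" 
    by (simp add: u_def linear_add[OF f(1)] linear_scale[OF f(1)])
  moreover have bb: "f (b * b) \<le> T"
    using f(2)[of "b * b"] norm_self_adjoint_square[OF b(1)] by (simp add: T_def)
  moreover have fe: "f e \<le> 1" using f(2)[of e] norm_unit_le by simp
  ultimately have "T * f e + f (b * b) \<ge> 2 * T" using f(3) nu by simp
  moreover have "T * f e \<le> T" using fe T by simp
  ultimately have fb: "f (b * b) = T" and "T * f e = T" using bb by linarith+
  then have "f e = 1" using T by simp
  then show ?thesis using that[of f] f fb unfolding real_state_def T_def by blast
qed

text \<open>From \<open>(1 - \<epsilon> b\<^sup>2)\<^sup>2 + 2 \<epsilon> b\<^sup>2 = 1 + \<epsilon>\<^sup>2 b\<^sup>4\<close> one has \<open>\<parallel>1 - \<epsilon> b\<^sup>2\<parallel>\<^sup>2 \<le> 1 + \<epsilon>\<^sup>2 \<parallel>b\<parallel>\<^sup>4\<close>,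
  which has no term of first order in \<open>\<epsilon>\<close>, whereas a negative value \<open>- m\<close> of \<open>f (b\<^sup>2)\<close> would force
  \<open>\<parallel>1 - \<epsilon> b\<^sup>2\<parallel> \<ge> 1 + \<epsilon> m\<close>.\<close>

lemma real_state_square_nonneg:
  assumes f: "real_state f" and b: "star b = b"
  shows "0 \<le> f (b * b)"
proof (rule ccontr)
  assume "\<not> 0 \<le> f (b * b)"
  then have neg: "0 < - f (b * b)" by simp
  define m where "m = - f (b * b)"
  define K where "K = (norm (b * b))\<^sup>2"
  have m: "0 < m" using neg by (simp add: m_def)
  have K: "0 < K" using neg real_stateD(6)[OF f] by (auto simp: K_def)
  define \<epsilon> where "\<epsilon> = m / K"
  have \<epsilon>: "0 < \<epsilon>" using m K by (simp add: \<epsilon>_def)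
  define u where "u = e - \<epsilon> *\<^sub>R (b * b)"
  define w where "w = sqrt (2 * \<epsilon>) *\<^sub>R b"
  have sa: "star u = u" "star w = w" by (simp_all add: u_def w_def cstar_simps b)
  have "1 + \<epsilon> * m = f u" using real_stateD[OF f] by (simp add: u_def m_def)
  also have "\<dots> \<le> norm u" by (rule real_stateD[OF f])
  finally have "(1 + \<epsilon> * m)\<^sup>2 \<le> (norm u)\<^sup>2" using \<epsilon> m by (intro power_mono) auto
  also have "\<dots> \<le> norm (u * u + w * w)"
    by (rule norm_square_le_sum_squares[OF sa]) (simp add: u_def w_def algebra_simps)
  also have "u * u + w * w = e + \<epsilon>\<^sup>2 *\<^sub>R ((b * b) * (b * b))"
  proof -
    have "w * w = (2 * \<epsilon>) *\<^sub>R (b * b)" using \<epsilon> by (simp add: w_def)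
    also have "\<dots> = \<epsilon> *\<^sub>R (b * b) + \<epsilon> *\<^sub>R (b * b)" by (simp flip: scaleR_left.add)
    finally show ?thesis by (simp add: u_def algebra_simps power2_eq_square)
  qed
  also have "norm \<dots> \<le> 1 + \<epsilon>\<^sup>2 * K"
  proof -
    have "norm ((b * b) * (b * b)) \<le> K"
      using norm_mult_ineq[of "b * b" "b * b"] by (simp add: K_def power2_eq_square)
    then have "\<epsilon>\<^sup>2 * norm ((b * b) * (b * b)) \<le> \<epsilon>\<^sup>2 * K" by (rule mult_left_mono) simp
    then show ?thesis
      using norm_triangle_ineq[of e "\<epsilon>\<^sup>2 *\<^sub>R ((b * b) * (b * b))"] norm_unit_le by simp
  qed
  finally have "2 * (\<epsilon> * m) + (\<epsilon> * m)\<^sup>2 \<le> \<epsilon>\<^sup>2 * K" by (simp add: power2_eq_square algebra_simps)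
  moreover have "\<epsilon>\<^sup>2 * K = \<epsilon> * m" using K by (simp add: \<epsilon>_def power2_eq_square)
  moreover have "0 < \<epsilon> * m" using \<epsilon> m by simp
  ultimately show False by (smt (verit) zero_le_power2)
qed

text \<open>The square root \<open>e - s\<close> of \<open>e - a\<close> solves \<open>s = (a + s\<^sup>2) / 2\<close>, a contraction on the ball of
  radius \<open>1/2\<close>.  The iteration stays in the closed set of self-adjoint elements that commute with
  the commutant of \<open>a\<close>.\<close>

lemma square_root_unit_minus:
  assumes a: "star a = a" "norm a \<le> 1/2"
  obtains r where "star r = r" "r * r = e - a" "\<And>v. v * a = a * v \<Longrightarrow> v * r = r * v"
proof -
  define X where "X = {s::'b. norm s \<le> 1/2 \<and> star s = s \<and> (\<forall>v. v * a = a * v \<longrightarrow> v * s = s * v)}"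
  define g where "g s = (1/2) *\<^sub>R (a + s * s)" for s :: 'b
  have lip: "dist (star x) (star y) = dist x y" for x y :: 'b
    by (simp add: dist_norm star_diff[symmetric])
  have cont: "continuous_on UNIV (star :: 'b \<Rightarrow> 'b)"
    unfolding continuous_on_iff lip by blast
  have "X = {s. norm s \<le> 1/2} \<inter> {s. star s = s} \<inter> (\<Inter>v\<in>{v. v * a = a * v}. {s. v * s = s * v})"
    by (auto simp: X_def)
  moreover have "closed \<dots>"
    by (intro closed_Int closed_INT ballI closed_Collect_le closed_Collect_eq continuous_intros cont)
  ultimately have "complete X" by (simp add: complete_eq_closed)
  moreover have "X \<noteq> {}" by (auto simp: X_def intro!: exI[of _ 0])
  moreover have "g ` X \<subseteq> X"
  proof (rule image_subsetI)
    fix s assume s: "s \<in> X"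
    have "norm s \<le> 1/2" using s unfolding X_def by blast
    then have "norm (s * s) \<le> 1/2 * (1/2)"
      by (intro order_trans[OF norm_mult_ineq mult_mono]) auto
    then have "norm (g s) \<le> 1/2"
      using norm_triangle_ineq[of a "s * s"] a by (simp add: g_def)
    moreover have "star (g s) = g s" 
    proof -
      have "star s = s" using s unfolding X_def by blast
      then show ?thesis using a by (simp add: g_def cstar_simps)
    qed
    moreover have "v * g s = g s * v" if "v * a = a * v" for v
    proof -
      have vs: "v * s = s * v" using s that unfolding X_def by blast
      then have "v * (s * s) = (s * s) * v" by (metis mult.assoc)
      then show ?thesis using that by (simp add: g_def algebra_simps)
    qed
    ultimately show "g s \<in> X" unfolding X_def by blast
  qed
  moreover have "dist (g s) (g t) \<le> 1/2 * dist s t" if "s \<in> X" "t \<in> X" for s t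
  proof -
    have eq: "g s - g t = (1/2) *\<^sub>R (s * (s - t) + (s - t) * t)" by (simp add: g_def algebra_simps)
    have st: "norm s \<le> 1/2" "norm t \<le> 1/2" using that unfolding X_def by blast+
    have "norm (s * (s - t)) \<le> 1/2 * norm (s - t)"
      by (rule order_trans[OF norm_mult_ineq mult_right_mono[OF st(1)]]) simp
    moreover have "norm ((s - t) * t) \<le> norm (s - t) * (1/2)"
      by (rule order_trans[OF norm_mult_ineq mult_left_mono[OF st(2)]]) simp
    ultimately show ?thesis
      using norm_triangle_ineq[of "s * (s - t)" "(s - t) * t"] unfolding dist_norm eq by simp
  qed
  ultimately have "\<exists>!s. s \<in> X \<and> g s = s"
    by (intro Banach_fix[of X "1/2" g]) auto
  then obtain s where s: "s \<in> X" "g s = s" by blast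
  have "a + s * s = 2 *\<^sub>R g s" by (simp add: g_def)
  then have "(e - s) * (e - s) = e - a" by (simp add: s(2) algebra_simps scaleR_2)
  moreover have "star (e - s) = e - s" 
  proof -
    have "star s = s" using s unfolding X_def by blast
    then show ?thesis by (simp add: cstar_simps)
  qed
  moreover have "v * (e - s) = (e - s) * v" if "v * a = a * v" for v
  proof -
    have "v * s = s * v" using s that unfolding X_def by blast
    then show ?thesis by (simp add: algebra_simps)
  qed
  ultimately show ?thesis using that by blast
qed


section \<open>Positivity at \<open>c\<^sup>* c\<close>\<close>

definition unit_power :: "'b \<Rightarrow> nat \<Rightarrow> 'b" where
  "unit_power z n = ((\<lambda>a. a * z) ^^ n) e"

lemma unit_power_simps [simp]:
  "unit_power z 0 = e" "unit_power z (Suc n) = unit_power z n * z"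
  by (simp_all add: unit_power_def)

lemma unit_power_intertwine: "c * z = z' * c \<Longrightarrow> c * unit_power z n = unit_power z' n * c"
  by (induction n) (simp_all, metis mult.assoc)

lemma unit_power_commute: "v * z = z * v \<Longrightarrow> v * unit_power z n = unit_power z n * v"
  by (rule unit_power_intertwine)

lemma unit_power_add: "unit_power z (m + n) = unit_power z m * unit_power z n"
  by (induction n) (simp_all add: mult.assoc)

lemma star_unit_power: "star z = z \<Longrightarrow> star (unit_power z n) = unit_power z n"
  by (induction n) (simp_all add: star_mult unit_power_commute)

lemma norm_unit_power_double:
  "star z = z \<Longrightarrow> norm (unit_power z (2 * n)) = (norm (unit_power z n))\<^sup>2"
  using norm_self_adjoint_square[of "unit_power z n"]
  by (simp add: mult_2 unit_power_add star_unit_power)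

text \<open>With \<open>a = star c * c\<close> and \<open>z = e - a\<close> the elements \<open>(c z\<^sup>n)\<^sup>* (c z\<^sup>n) = a z\<^sup>2\<^sup>n\<close> decrease in
  \<open>n\<close>: two consecutive ones differ by \<open>a\<^sup>2 z\<^sup>2\<^sup>n (e + z)\<close>, the square of \<open>a z\<^sup>n (e + z)\<^sup>1\<^sup>/\<^sup>2\<close>.
  The root exists because \<open>e + z = 2 (e - a / 2)\<close>.\<close>

lemma real_state_compressed_le:
  assumes f: "real_state f" and c: "norm c \<le> 1"
  shows "f (star (c * unit_power (e - star c * c) n) * (c * unit_power (e - star c * c) n)) \<le> 1"
proof -
  define a where "a = star c * c"
  define z where "z = e - a"
  have sa: "star a = a" "star z = z" by (simp_all add: a_def z_def cstar_simps)
  have na: "norm a \<le> 1" using c by (simp add: a_def cstar_identity power_le_one)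
  have h: "star ((1/2) *\<^sub>R a) = (1/2) *\<^sub>R a" "norm ((1/2) *\<^sub>R a) \<le> 1/2"
    using na sa by (simp_all add: star_scaleR)
  obtain r where r: "star r = r" "r * r = e - (1/2) *\<^sub>R a"
      "\<And>v. v * ((1/2) *\<^sub>R a) = ((1/2) *\<^sub>R a) * v \<Longrightarrow> v * r = r * v"
    using square_root_unit_minus[OF h] by blast
  define s where "s = sqrt 2 *\<^sub>R r"
  have ss: "s * s = e + z" by (simp add: s_def r z_def scaleR_diff_right scaleR_2)
  have s: "star s = s" by (simp add: s_def r star_scaleR)
  have za: "a * z = z * a" by (simp add: z_def algebra_simps)
  have "f (star (c * unit_power z n) * (c * unit_power z n)) \<le> 1"
  proof (induction n)
    case 0
    have "f a \<le> 1" using real_stateD(1)[OF f, of a] na by simp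
    then show ?case by (simp add: a_def)
  next
    case (Suc n)
    define w where "w = unit_power z n"
    have w: "star w = w" "a * w = w * a" "z * w = w * z"
      by (simp_all add: w_def star_unit_power sa unit_power_commute za)
    define q where "q = a * w * s"
    have s_comm: "v * s = s * v" if "v * a = a * v" for v
      using r(3)[of v] that by (simp add: s_def)
    have sc: "a * s = s * a" "w * s = s * w" "z * s = s * z"
      by (auto intro!: s_comm simp: w za)
    have "star q = s * (w * a)" by (simp add: q_def star_mult s w sa)
    also have "\<dots> = q" unfolding q_def by (metis mult.assoc sc(1,2) w(2))
    finally have "star q = q" .
    then have "0 \<le> f (q * q)" by (rule real_state_square_nonneg[OF f])
    also have "q * q = a * w * (s * (a * w)) * s" by (simp add: q_def mult.assoc)
    also have "s * (a * w) = a * w * s" by (metis mult.assoc sc(1,2))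
    also have "a * w * (a * w * s) * s = a * w * (a * w) * (s * s)" by (simp add: mult.assoc)
    also have "\<dots> = a * w * (a * w) + a * w * (a * w) * z"
      by (simp add: ss algebra_simps)
    also have "\<dots> = w * a * w - w * z * a * (w * z)"
    proof -
      have "w * z * a * (w * z) = w * (z * a) * (w * z)" by (simp add: mult.assoc)
      also have "\<dots> = w * a * (z * w) * z" by (simp add: za[symmetric] mult.assoc)
      also have "\<dots> = w * a * w * (z * z)" by (simp only: w(3) mult.assoc)
      finally have "w * z * a * (w * z) = w * a * w * (z * z)" .
      moreover have "a * w * (a * w) = w * a * w * a"
        unfolding w(2) by (simp add: mult.assoc)
      moreover have "p * a + p * a * z = p - p * (z * z)" for p
        by (simp add: z_def algebra_simps)
      ultimately show ?thesis by (simp only:)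
    qed
    finally have "0 \<le> f (w * a * w) - f (w * z * a * (w * z))"
      by (simp add: real_stateD[OF f])
    moreover have "f (w * a * w) \<le> 1"
      using Suc by (simp add: star_mult w(1) a_def mult.assoc flip: w_def)
    moreover have "star (c * (w * z)) * (c * (w * z)) = w * z * a * (w * z)"
      by (simp add: star_mult w sa a_def mult.assoc)
    ultimately show ?case by (simp flip: w_def)
  qed
  then show ?thesis by (simp add: z_def a_def)
qed

text \<open>With the Cartesian decomposition \<open>d = h - \<i> k\<close> the sum \<open>d\<^sup>* d + d d\<^sup>*\<close> is \<open>2 h\<^sup>2 + 2 k\<^sup>2\<close>.  The
  term with \<open>k\<close> is nonnegative in every real state, and some real state attains \<open>\<parallel>h\<parallel>\<^sup>2\<close> at \<open>h\<^sup>2\<close>.\<close>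

lemma norm_real_part_le_of_real_states:
  assumes "\<And>f. real_state f \<Longrightarrow> f (star d * d) + f (d * star d) \<le> 2"
  shows "norm (real_part d) \<le> 1"
proof (cases "real_part d = 0")
  case False
  let ?h = "real_part d" and ?k = "real_part (\<i> *\<^sub>C d)"
  obtain f where f: "real_state f" "f (?h * ?h) = (norm ?h)\<^sup>2"
    by (rule real_state_attains_norm_square[OF star_real_part False])
  have "2 * f (?h * ?h) + 2 * f (?k * ?k) = f (star d * d) + f (d * star d)"
    using arg_cong[OF star_mult_add_mult_star[of d], of f] by (simp add: real_stateD[OF f(1)])
  moreover have "0 \<le> f (?k * ?k)" by (rule real_state_square_nonneg[OF f(1)]) simp
  ultimately have "(norm ?h)\<^sup>2 \<le> 1" using assms[OF f(1)] f(2) by simp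
  then show ?thesis by (simp add: power2_le_imp_le abs_square_le_1)
qed simp

text \<open>Both \<open>d\<^sup>* d\<close> and \<open>d d\<^sup>*\<close> are bounded above by \<open>1\<close> in every real state, because \<open>d\<^sup>*\<close> has the
  same form as \<open>d\<close>, with \<open>c\<^sup>*\<close> in place of \<open>c\<close>.  Their sum is twice a sum of two squares of
  self-adjoint elements, so this upper bound is a norm bound.\<close>

lemma norm_compressed_le:
  assumes c: "norm c \<le> 1"
  shows "norm (c * unit_power (e - star c * c) n) \<le> 2"
proof -
  define z where "z = e - star c * c"
  define z' where "z' = e - c * star c"
  define d where "d = c * unit_power z n"
  have sz: "star z = z" "star z' = z'" by (simp_all add: z_def z'_def cstar_simps)
  have "c * z = z' * c" by (simp add: z_def z'_def algebra_simps)
  then have d': "d = unit_power z' n * c" by (simp add: d_def unit_power_intertwine)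
  have 1: "f (star d * d) + f (d * star d) \<le> 2" if f: "real_state f" for f
  proof -
    have "f (star d * d) \<le> 1"
      using real_state_compressed_le[OF f c, of n] by (simp add: d_def z_def)
    moreover have "star d = star c * unit_power z' n" by (simp add: d' star_mult star_unit_power sz)
    then have "f (d * star d) \<le> 1"
      using real_state_compressed_le[OF f, of "star c" n] c by (simp add: z'_def star_star)
        (metis star_star)
    ultimately show ?thesis by simp
  qed
  have "norm (real_part d) \<le> 1" by (rule norm_real_part_le_of_real_states[OF 1])
  moreover have "norm (real_part (\<i> *\<^sub>C d)) \<le> 1"
    by (rule norm_real_part_le_of_real_states) (use 1 in \<open>simp add: cstar_simps\<close>)
  ultimately have "norm d \<le> 2"
    using norm_triangle_ineq4[of "real_part d" "\<i> *\<^sub>C real_part (\<i> *\<^sub>C d)"] cartesian[of d]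
    by (simp add: norm_scaleC)
  then show ?thesis by (simp add: d_def z_def)
qed

text \<open>The differences \<open>z\<^sup>n - z\<^sup>n\<^sup>+\<^sup>1 = star c * (c z\<^sup>n)\<close> are bounded, so the powers of the self-adjoint
  \<open>z\<close> grow at most linearly, whereas \<open>\<parallel>z\<^sup>2\<^sup>n\<parallel> = \<parallel>z\<^sup>n\<parallel>\<^sup>2\<close>.\<close>

lemma norm_unit_minus_star_mult_le:
  assumes c: "norm c \<le> 1"
  shows "norm (e - star c * c) \<le> 1"
proof (rule ccontr)
  define z where "z = e - star c * c"
  assume "\<not> norm (e - star c * c) \<le> 1"
  then have gt: "1 < norm z" by (simp add: z_def)
  have sz: "star z = z" by (simp add: z_def cstar_simps)
  have linear_growth: "norm (unit_power z n) \<le> 1 + 2 * real n" for n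
  proof (induction n)
    case (Suc n)
    have "z * unit_power z n = unit_power z n * z" by (rule unit_power_commute) simp
    then have "unit_power z (Suc n) = unit_power z n - star c * (c * unit_power z n)"
      by (simp add: z_def algebra_simps)
    moreover have "norm (star c * (c * unit_power z n)) \<le> 1 * 2"
      by (rule order_trans[OF norm_mult_ineq mult_mono])
        (use c norm_compressed_le[OF c, of n] in \<open>simp_all add: z_def\<close>)
    ultimately show ?case
      using Suc norm_triangle_ineq4[of "unit_power z n" "star c * (c * unit_power z n)"] by simp
  qed (use norm_unit_le in simp)
  have pow: "norm (unit_power z (2 ^ m)) = norm z ^ (2 ^ m)" for m
    by (induction m) (simp_all add: norm_unit_power_double sz power_mult[symmetric] mult.commute)
  have "(\<lambda>n. real n / norm z ^ n) \<longlonglongrightarrow> 0"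
    using lim_n_over_pown[of "norm z"] gt by simp
  then have "\<forall>\<^sub>F n in sequentially. real n / norm z ^ n < 1/3"
    by (rule order_tendstoD) simp
  then obtain N where N: "\<And>n. n \<ge> N \<Longrightarrow> real n / norm z ^ n < 1/3"
    by (auto simp: eventually_sequentially)
  define n where "n = (2::nat) ^ N"
  have "N \<le> n" "1 \<le> n" by (simp_all add: n_def less_imp_le)
  have "real n / norm z ^ n < 1/3" using N[OF \<open>N \<le> n\<close>] .
  moreover have "0 < norm z ^ n" by (rule zero_less_power) (use gt in linarith)
  ultimately have "real n < 1/3 * norm z ^ n" by (simp only: pos_divide_less_eq)
  then have "3 * real n < norm z ^ n" by linarith
  also have "\<dots> \<le> 1 + 2 * real n" using pow[of N] linear_growth[of n] by (simp add: n_def)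
  finally show False using \<open>1 \<le> n\<close> by simp
qed

text \<open>For \<open>\<parallel>b\<parallel> \<le> 1\<close> a real state \<open>f\<close> satisfies \<open>1 - f (b\<^sup>* b) = f (e - b\<^sup>* b) \<le> 1\<close>.\<close>

lemma real_state_star_mult_nonneg:
  assumes f: "real_state f"
  shows "0 \<le> f (star c * c)"
proof (cases "c = 0")
  case True
  then show ?thesis by (simp add: real_stateD[OF f])
next
  case False
  define b where "b = inverse (norm c) *\<^sub>R c"
  have b: "norm b \<le> 1" using False by (simp add: b_def)
  have "1 - f (star b * b) = f (e - star b * b)" by (simp add: real_stateD[OF f])
  also have "\<dots> \<le> 1"
    using real_stateD(1)[OF f, of "e - star b * b"] norm_unit_minus_star_mult_le[OF b] by simp
  finally have "0 \<le> f (star b * b)" by simp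
  moreover have "star c * c = (norm c)\<^sup>2 *\<^sub>R (star b * b)"
  proof -
    have "(norm c)\<^sup>2 * (inverse (norm c) * inverse (norm c)) = 1"
      using False by (simp add: power2_eq_square field_simps)
    then show ?thesis by (simp add: b_def star_scaleR mult.assoc)
  qed
  ultimately show ?thesis by (simp add: real_stateD[OF f])
qed

text \<open>A real state, composed with the real part and complexified, is a state.\<close>

lemma state_attains_norm_square:
  assumes b: "star (b :: 'b) = b" "b \<noteq> 0"
  obtains \<phi> where "state \<phi>" "\<phi> (b * b) = complex_of_real ((norm b)\<^sup>2)"
proof -
  obtain f where f: "real_state f" "f (b * b) = (norm b)\<^sup>2"
    by (rule real_state_attains_norm_square[OF b])
  note fD = real_stateD[OF f(1)]
  define \<phi> where "\<phi> x = Complex (f (real_part x)) (- f (real_part (\<i> *\<^sub>C x)))" for x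
  have add: "\<phi> (x + y) = \<phi> x + \<phi> y" for x y
    by (simp add: \<phi>_def real_part_add scaleC_add_right fD complex_eq_iff)
  have real: "\<phi> (r *\<^sub>R x) = complex_of_real r * \<phi> x" for r x
    by (simp add: \<phi>_def real_part_scaleR scaleC_scaleR fD complex_eq_iff)
  have imag: "\<phi> (\<i> *\<^sub>C x) = \<i> * \<phi> x" for x
  proof -
    have "real_part (- x) = - real_part x" using real_part_scaleR[of "-1" x] by simp
    then have "f (real_part (- x)) = - f (real_part x)"
      using fD(5)[of "-1" "real_part x"] by simp
    then show ?thesis by (simp add: \<phi>_def scaleC_scaleC scaleC_minus_left complex_eq_iff)
  qed
  have scale: "\<phi> (c *\<^sub>C x) = c * \<phi> x" for c x
  proof -
    have "c *\<^sub>C x = (complex_of_real (Re c) + complex_of_real (Im c) * \<i>) *\<^sub>C x"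
      using complex_eq[of c] by (simp add: mult.commute)
    also have "\<dots> = Re c *\<^sub>R x + Im c *\<^sub>R (\<i> *\<^sub>C x)"
      by (simp add: scaleC_add_left scaleC_of_real flip: scaleC_scaleC)
    finally have "\<phi> (c *\<^sub>C x) = (complex_of_real (Re c) + complex_of_real (Im c) * \<i>) * \<phi> x"
      by (simp add: add real imag algebra_simps)
    then show ?thesis using complex_eq[of c] by (simp add: mult.commute)
  qed
  have bound: "cmod (\<phi> x) \<le> norm x" for x
  proof (cases "\<phi> x = 0")
    case False
    \<comment> \<open>rotate \<open>x\<close> so that its value becomes real\<close>
    define u where "u = complex_of_real (cmod (\<phi> x)) / \<phi> x"
    have "cmod (\<phi> x) = Re (\<phi> (u *\<^sub>C x))" using False by (simp add: scale u_def)
    also have "\<dots> \<le> norm (u *\<^sub>C x)"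
      using fD(1)[of "real_part (u *\<^sub>C x)"] norm_real_part[of "u *\<^sub>C x"] by (simp add: \<phi>_def)
    also have "\<dots> = norm x" using False by (simp add: norm_scaleC u_def norm_divide)
    finally show ?thesis .
  qed simp
  have self_adjoint: "\<phi> x = complex_of_real (f x)" if "star x = x" for x
    using that by (simp add: \<phi>_def real_part_self_adjoint real_part_ii_self_adjoint fD complex_eq_iff)
  have bl: "bounded_linear \<phi>"
    by (rule bounded_linear_intro[of _ 1]) (simp_all add: add real bound scaleR_conv_of_real)
  have "onorm \<phi> = 1"
  proof (rule antisym)
    show "onorm \<phi> \<le> 1" by (rule onorm_bound) (simp_all add: bound)
    have "\<phi> e = 1" using self_adjoint[of e] fD by simp
    then show "1 \<le> onorm \<phi>" using onorm[OF bl, of e] norm_unit[OF b(2)] by simp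
  qed
  moreover have "\<phi> (star x * x) \<in> \<real>\<^sub>\<ge>\<^sub>0" for x
    using self_adjoint[of "star x * x"] real_state_star_mult_nonneg[OF f(1), of x]
    by (simp add: star_mult star_star)
  ultimately have "state \<phi>" using bl scale by (simp add: state_def)
  moreover have "\<phi> (b * b) = complex_of_real ((norm b)\<^sup>2)"
    using self_adjoint[of "b * b"] f(2) b by (simp add: star_mult)
  ultimately show ?thesis by (rule that)
qed

text \<open>For a state that attains the norm \<open>t\<^sup>2\<close> of \<open>s\<^sup>2\<close>, where \<open>t = \<parallel>s\<parallel>\<close>, the positivity of
  \<open>(t - s) s (t - s)\<close> gives \<open>\<phi> (s\<^sup>3) \<ge> 2 t\<^sup>3 - t\<^sup>2 \<phi> s \<ge> t\<^sup>3\<close>.\<close>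

lemma norm_sum_mult_star_le:
  fixes x :: "'j \<Rightarrow> 'b"
  defines "s \<equiv> \<lambda>F. \<Sum>j\<in>F. x j * star (x j)"
  assumes bound: "\<And>\<phi>. state \<phi> \<Longrightarrow> Re (\<phi> (s F * s F * s F)) \<le> K * Re (\<phi> (s F * s F))"
    and "0 < K"
  shows "norm (s F) \<le> K"
proof (cases "s F = 0")
  case False
  define S where "S = s F"
  have S: "star S = S" by (simp add: S_def s_def star_sum star_mult star_star)
  obtain \<phi> where \<phi>: "state \<phi>" "\<phi> (S * S) = complex_of_real ((norm S)\<^sup>2)"
    using state_attains_norm_square[OF S] False by (auto simp: S_def)
  define t where "t = norm S"
  have t: "0 < t" using False by (simp add: t_def S_def)
  have bl: "bounded_linear \<phi>" and pos: "\<And>a. \<phi> (star a * a) \<in> \<real>\<^sub>\<ge>\<^sub>0" and on: "onorm \<phi> = 1"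
    using \<phi>(1) by (simp_all add: state_def)
  interpret bounded_linear \<phi> by (rule bl)
  define v where "v = t *\<^sub>R e - S"
  have sv: "star v = v" by (simp add: v_def cstar_simps S)
  have "v * S * v = (\<Sum>j\<in>F. star (star (x j) * v) * (star (x j) * v))"
    by (simp add: S_def s_def sum_distrib_left sum_distrib_right star_mult star_star sv mult.assoc)
  then have "0 \<le> Re (\<phi> (v * S * v))"
    using pos by (auto simp: sum complex_nonneg_Reals_iff intro!: sum_nonneg)
  also have "v * S * v = S * S * S - (2 * t) *\<^sub>R (S * S) + t\<^sup>2 *\<^sub>R S"
    by (simp add: v_def algebra_simps power2_eq_square scaleR_2 flip: scaleR_scaleR)
  also have "Re (\<phi> \<dots>) = Re (\<phi> (S * S * S)) - 2 * t * t\<^sup>2 + t\<^sup>2 * Re (\<phi> S)"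
    by (simp add: add diff scaleR \<phi>(2) flip: t_def)
  finally have "2 * t * t\<^sup>2 \<le> Re (\<phi> (S * S * S)) + t\<^sup>2 * Re (\<phi> S)" by simp
  also have "Re (\<phi> (S * S * S)) \<le> K * t\<^sup>2"
    using bound[OF \<phi>(1)] \<phi>(2) by (simp add: t_def S_def)
  also have "t\<^sup>2 * Re (\<phi> S) \<le> t\<^sup>2 * t"
    using onorm[OF bl, of S] complex_Re_le_cmod[of "\<phi> S"] by (intro mult_left_mono) (auto simp: on t_def)
  finally have "t * t\<^sup>2 \<le> K * t\<^sup>2" by simp
  then show ?thesis using t by (simp add: t_def S_def)
qed (use \<open>0 < K\<close> in simp)

end


section \<open>States as vector functionals of the universal representation\<close>

lemma state_linear:
  assumes "state \<phi>"
  shows "\<phi> (a + b) = \<phi> a + \<phi> b" "\<phi> (c *\<^sub>C a) = c * \<phi> a" "\<phi> 0 = 0"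
    "\<phi> (sum g F) = (\<Sum>j\<in>F. \<phi> (g j))"
    "\<phi> (r *\<^sub>R a) = complex_of_real r * \<phi> a"
proof -
  interpret bounded_linear \<phi> using assms by (simp add: state_def)
  show "\<phi> (a + b) = \<phi> a + \<phi> b" "\<phi> (c *\<^sub>C a) = c * \<phi> a" "\<phi> 0 = 0"
    "\<phi> (sum g F) = (\<Sum>j\<in>F. \<phi> (g j))"  "\<phi> (r *\<^sub>R a) = complex_of_real r * \<phi> a"
    using assms by (simp_all add: state_def add sum scaleR scaleR_conv_of_real)
qed

lemma state_positive:
  assumes "state \<phi>"
  shows "0 \<le> Re (\<phi> (star a * a))" "Im (\<phi> (star a * a)) = 0"
  using assms by (simp_all add: state_def complex_nonneg_Reals_iff)

text \<open>Polarization: the values at \<open>(a + b)\<^sup>* (a + b)\<close> and \<open>(a + \<i> b)\<^sup>* (a + \<i> b)\<close> are real.\<close>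

lemma state_hermitian:
  assumes \<phi>: "state \<phi>"
  shows "\<phi> (star b * a) = cnj (\<phi> (star a * b))"
proof -
  have "Im (\<phi> (star (a + b) * (a + b))) = 0" "Im (\<phi> (star (a + \<i> *\<^sub>C b) * (a + \<i> *\<^sub>C b))) = 0"
    by (rule state_positive[OF \<phi>])+
  then show ?thesis
    using state_positive(2)[OF \<phi>, of a] state_positive(2)[OF \<phi>, of b]
    by (simp add: cstar_simps distrib_left distrib_right state_linear[OF \<phi>] complex_eq_iff
        flip: scaleC_minus_left)
qed

lemma state_quadratic:
  assumes \<phi>: "state \<phi>"
  shows "Re (\<phi> (star (a + c *\<^sub>C b) * (a + c *\<^sub>C b)))
    = Re (\<phi> (star a * a)) + 2 * Re (c * \<phi> (star a * b)) + (cmod c)\<^sup>2 * Re (\<phi> (star b * b))"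
proof -
  have "\<phi> (star (a + c *\<^sub>C b) * (a + c *\<^sub>C b)) = \<phi> (star a * a)
      + (c * \<phi> (star a * b) + cnj (c * \<phi> (star a * b))) + (c * cnj c) * \<phi> (star b * b)"
    by (simp add: cstar_simps distrib_left distrib_right state_linear[OF \<phi>]
        state_hermitian[OF \<phi>, of b a] mult_ac)
  then show ?thesis by (simp add: complex_add_cnj flip: complex_norm_square)
qed

lemma state_Cauchy_Schwarz:
  assumes \<phi>: "state \<phi>"
  shows "(cmod (\<phi> (star a * b)))\<^sup>2 \<le> Re (\<phi> (star a * a)) * Re (\<phi> (star b * b))"
proof -
  define A where "A = Re (\<phi> (star a * a))"
  define B where "B = Re (\<phi> (star b * b))"
  define w where "w = \<phi> (star a * b)"
  have A: "0 \<le> A" and B: "0 \<le> B" by (simp_all add: A_def B_def state_positive[OF \<phi>])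
  have q: "0 \<le> A - 2 * t * (cmod w)\<^sup>2 + t\<^sup>2 * (cmod w)\<^sup>2 * B" for t :: real
  proof -
    define c where "c = - complex_of_real t * cnj w"
    have "0 \<le> A + 2 * Re (c * w) + (cmod c)\<^sup>2 * B"
      unfolding A_def B_def w_def state_quadratic[OF \<phi>, symmetric] by (rule state_positive[OF \<phi>])
    moreover have "c * w = complex_of_real (- t * (cmod w)\<^sup>2)"
      using complex_norm_square[of w] by (simp add: c_def mult.commute)
    then have "Re (c * w) = - t * (cmod w)\<^sup>2" by (simp only: Re_complex_of_real)
    moreover have "(cmod c)\<^sup>2 = t\<^sup>2 * (cmod w)\<^sup>2"
      by (simp add: c_def norm_mult power_mult_distrib)
    ultimately show ?thesis by simp
  qed
  show ?thesis
  proof (cases "B = 0")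
    case True
    have "(cmod w)\<^sup>2 = 0"
    proof (rule ccontr)
      assume "(cmod w)\<^sup>2 \<noteq> 0"
      then show False using q[of "(A + 1) / (2 * (cmod w)\<^sup>2)"] True by simp
    qed
    then show ?thesis using True by (simp add: w_def B_def)
  next
    case False
    then have "0 \<le> A - 2 * (1 / B) * (cmod w)\<^sup>2 + (1 / B)\<^sup>2 * (cmod w)\<^sup>2 * B" by (intro q)
    also have "\<dots> = A - (cmod w)\<^sup>2 / B" using False by (simp add: power2_eq_square field_simps)
    finally show ?thesis using False B
      by (simp add: field_simps flip: A_def B_def w_def)
  qed
qed

definition gns_vector :: "('b::cstar_algebra \<Rightarrow> complex) \<Rightarrow> 'b \<Rightarrow> 'b \<Rightarrow> complex" where
  "gns_vector \<phi> b = (\<lambda>a. \<phi> (star a * b))"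

lemma gns_vector_in_gns_space: "state \<phi> \<Longrightarrow> gns_vector \<phi> b \<in> gns_space \<phi>"
  unfolding gns_space_def gns_vector_def
  by (auto simp: cstar_simps distrib_right state_linear mult.commute
      intro!: exI[of _ "Re (\<phi> (star b * b))"] state_Cauchy_Schwarz)

lemma gns_norm_gns_vector:
  assumes \<phi>: "state \<phi>"
  shows "(gns_norm \<phi> (gns_vector \<phi> b))\<^sup>2 = Re (\<phi> (star b * b))"
proof -
  define B where "B = Re (\<phi> (star b * b))"
  have B: "0 \<le> B" by (simp add: B_def state_positive[OF \<phi>])
  have le: "cmod (\<phi> (star a * b)) \<le> sqrt B" if "Re (\<phi> (star a * a)) \<le> 1" for a
  proof (rule real_le_rsqrt)
    have "(cmod (\<phi> (star a * b)))\<^sup>2 \<le> Re (\<phi> (star a * a)) * B"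
      using state_Cauchy_Schwarz[OF \<phi>, of a b] by (simp add: B_def)
    also have "\<dots> \<le> 1 * B" by (rule mult_right_mono[OF that B])
    finally show "(cmod (\<phi> (star a * b)))\<^sup>2 \<le> B" by simp
  qed
  \<comment> \<open>the supremum is attained at \<open>b\<close> normalized\<close>
  have "\<exists>a. Re (\<phi> (star a * a)) \<le> 1 \<and> cmod (\<phi> (star a * b)) = sqrt B"
  proof (cases "B = 0")
    case False
    define r where "r = inverse (sqrt B)"
    have r: "r * r * B = 1" "r * B = sqrt B"
      using B False by (simp_all add: r_def field_simps)
    have "\<phi> (star b * b) = complex_of_real B"
      by (simp add: complex_eq_iff B_def state_positive[OF \<phi>])
    then have "\<phi> (star (r *\<^sub>R b) * (r *\<^sub>R b)) = complex_of_real (r * r * B)"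
      "\<phi> (star (r *\<^sub>R b) * b) = complex_of_real (r * B)"
      by (simp_all add: star_scaleR state_linear[OF \<phi>])
    then show ?thesis
      using r B by (intro exI[of _ "r *\<^sub>R b"]) (simp add: norm_mult del: of_real_mult)
  qed (auto intro!: exI[of _ 0] simp: state_linear[OF \<phi>])
  then have "gns_norm \<phi> (gns_vector \<phi> b) = sqrt B"
    unfolding gns_norm_def gns_vector_def using le
    by (intro cSup_eq_maximum) force+
  then show ?thesis using B by (simp add: B_def)
qed

lemma gns_norm_zero:
  assumes \<phi>: "state \<phi>"
  shows "gns_norm \<phi> (\<lambda>a. 0) = 0"
proof -
  have "{a. Re (\<phi> (star a * a)) \<le> 1} \<noteq> {}"
    using state_linear(3)[OF \<phi>] by (auto intro!: exI[of _ 0])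
  then show ?thesis by (simp add: gns_norm_def)
qed

text \<open>The four norms in the polarization formula coincide, and the powers of \<open>- \<i>\<close> sum to zero.\<close>

lemma gns_inner_zero_left: "gns_inner \<phi> (\<lambda>a. 0) \<eta> = 0"
proof -
  have "gns_norm \<phi> (\<lambda>a. 0 + \<i> ^ k * \<eta> a) = gns_norm \<phi> \<eta>" for k
    by (simp add: gns_norm_def norm_mult norm_power)
  then show ?thesis by (simp add: gns_inner_def eval_nat_numeral algebra_simps)
qed

lemma gns_inner_gns_vector:
  assumes \<phi>: "state \<phi>"
  shows "gns_inner \<phi> (gns_vector \<phi> a) (gns_vector \<phi> b) = \<phi> (star a * b)"
proof -
  have "(\<lambda>x. gns_vector \<phi> a x + c * gns_vector \<phi> b x) = gns_vector \<phi> (a + c *\<^sub>C b)" for c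
    by (simp add: gns_vector_def distrib_left scaleC_mult_right state_linear[OF \<phi>])
  then have norms: "(gns_norm \<phi> (\<lambda>x. gns_vector \<phi> a x + c * gns_vector \<phi> b x))\<^sup>2
      = Re (\<phi> (star a * a)) + 2 * Re (c * \<phi> (star a * b)) + (cmod c)\<^sup>2 * Re (\<phi> (star b * b))" for c
    by (simp add: gns_norm_gns_vector[OF \<phi>] state_quadratic[OF \<phi>])
  show ?thesis
    unfolding gns_inner_def norms
    by (simp add: eval_nat_numeral complex_eq_iff algebra_simps)
qed

text \<open>The universal vector whose only nonzero component is the cyclic vector of the GNS
  representation of \<open>\<phi>\<close>.\<close>

definition cyclic_vector :: "'b::cstar_algebra \<Rightarrow> ('b \<Rightarrow> complex) \<Rightarrow> 'b universal_vector" where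
  "cyclic_vector e \<phi> = (\<lambda>\<psi>. if \<psi> = \<phi> then gns_vector \<phi> e else (\<lambda>a. 0))"

lemma zero_in_gns_space: "(\<lambda>a. 0) \<in> gns_space \<phi>"
  by (auto simp: gns_space_def intro!: exI[of _ 0])

lemma zero_in_universal_space: "(\<lambda>\<psi> a. 0) \<in> universal_space"
  by (auto simp: universal_space_def zero_in_gns_space gns_norm_zero
      intro!: summable_on_0)

lemma cyclic_vector_in_universal_space:
  assumes \<phi>: "state \<phi>"
  shows "cyclic_vector e \<phi> \<in> universal_space"
proof -
  have "(\<lambda>\<psi>. (gns_norm \<psi> (cyclic_vector e \<phi> \<psi>))\<^sup>2) summable_on {\<phi>}"
    by simp
  then have "(\<lambda>\<psi>. (gns_norm \<psi> (cyclic_vector e \<phi> \<psi>))\<^sup>2) summable_on {\<psi>. state \<psi>}"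
    by (rule summable_on_cong_neutral[THEN iffD1, rotated -1])
      (auto simp: \<phi> cyclic_vector_def gns_norm_zero)
  then show ?thesis
    using \<phi> by (auto simp: universal_space_def cyclic_vector_def gns_vector_in_gns_space
        zero_in_gns_space)
qed

lemma universal_inner_zero_left: "universal_inner (\<lambda>\<psi> a. 0) \<eta> = 0"
  by (simp add: universal_inner_def gns_inner_zero_left)

context unital_cstar_algebra
begin

lemma universal_inner_cyclic_vector:
  assumes \<phi>: "state \<phi>"
  shows "universal_inner (cyclic_vector e \<phi>) (universal_rep b (cyclic_vector e \<phi>)) = \<phi> b"
proof -
  let ?\<xi> = "cyclic_vector e \<phi>"
  have cyc: "?\<xi> \<psi> = (if \<psi> = \<phi> then gns_vector \<phi> e else (\<lambda>a. 0))" for \<psi>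
    by (simp add: cyclic_vector_def)
  have rep: "universal_rep b ?\<xi> \<psi> = (if \<psi> = \<phi> then gns_vector \<phi> b else (\<lambda>a. 0))" for \<psi>
    using cyclic_vector_in_universal_space[OF \<phi>, of e]
    by (auto simp: universal_rep_def cyclic_vector_def gns_vector_def star_mult star_star)
  have "universal_inner ?\<xi> (universal_rep b ?\<xi>)
      = (\<Sum>\<^sub>\<infinity>\<psi>\<in>{\<phi>}. gns_inner \<psi> (?\<xi> \<psi>) (universal_rep b ?\<xi> \<psi>))"
    unfolding universal_inner_def
    by (rule infsum_cong_neutral) (auto simp: \<phi> cyc gns_inner_zero_left)
  also have "\<dots> = \<phi> b"
    using gns_inner_gns_vector[OF \<phi>, of e b] by (simp add: rep cyc)
  finally show ?thesis .
qed

text \<open>Ultraweak convergence implies convergence at every vector functional.  Positivity of the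
  terms makes the values of a state at the partial sums increase to the value at the limit, which
  the operator inequality bounds.\<close>

lemma state_partial_sum_le:
  assumes lim: "limitin ultraweak_topology (\<lambda>F. universal_rep (\<Sum>j\<in>F. star (g j) * g j)) T
      (finite_subsets_at_top J)"
    and le: "operator_le T (universal_rep (p :: 'b))"
    and F: "finite F" "F \<subseteq> J"
    and \<phi>: "state \<phi>"
  shows "Re (\<phi> (\<Sum>j\<in>F. star (g j) * g j)) \<le> Re (\<phi> p)"
proof (rule ccontr)
  define \<xi> where "\<xi> = cyclic_vector e \<phi>"
  let ?z = "(\<lambda>\<psi> a. 0) :: 'b universal_vector"
  let ?G = "\<lambda>F. \<Sum>j\<in>F. star (g j) * g j"
  \<comment> \<open>the vector functional of \<open>\<xi>\<close>, as a series with one nonzero term\<close>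
  define \<xi>s where "\<xi>s n = (if n = 0 then \<xi> else ?z)" for n :: nat
  define \<omega> where "\<omega> T = (\<Sum>n. universal_inner (\<xi>s n) (T (\<xi>s n)))"
    for T :: "'b universal_vector \<Rightarrow> 'b universal_vector"
  have \<xi>: "\<xi> \<in> universal_space"
    unfolding \<xi>_def by (rule cyclic_vector_in_universal_space[OF \<phi>])
  have rep: "universal_inner \<xi> (universal_rep b \<xi>) = \<phi> b" for b
    unfolding \<xi>_def by (rule universal_inner_cyclic_vector[OF \<phi>])
  have "square_summable \<xi>s"
    unfolding square_summable_def
  proof
    show "\<forall>n. \<xi>s n \<in> universal_space" 
      using \<xi> zero_in_universal_space by (auto simp: \<xi>s_def)
    show "summable (\<lambda>n. (universal_norm (\<xi>s n))\<^sup>2)"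
      by (rule summable_finite[of "{0}"])
        (auto simp: \<xi>s_def universal_norm_def universal_inner_zero_left)
  qed
  then have \<omega>: "\<omega> \<in> ultraweak_functionals"
    unfolding ultraweak_functionals_def \<omega>_def[abs_def] by blast
  assume "\<not> ?thesis"
  then have less: "Re (\<phi> p) < Re (\<phi> (?G F))" by simp
  have \<omega>_eq: "\<omega> S = universal_inner \<xi> (S \<xi>)" for S
    unfolding \<omega>_def
    by (subst suminf_finite[of "{0}"]) (auto simp: \<xi>s_def universal_inner_zero_left)
  define U where "U = {z. Re z < Re (\<phi> (?G F))}"
  define N where "N = {S \<in> enveloping_vN. \<omega> S \<in> U}"
  have "open U" unfolding U_def by (intro open_Collect_less continuous_intros)
  then have "openin ultraweak_topology N"
    unfolding ultraweak_topology_def N_def using \<omega> by (intro topology_generated_by_Basis) blast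
  moreover have "T \<in> N"
  proof -
    have "T \<in> topspace ultraweak_topology" using lim by (simp add: limitin_def)
    then have "T \<in> enveloping_vN"
      by (auto simp: ultraweak_topology_def)
    moreover have "Re (\<omega> T) \<le> Re (\<phi> p)"
      using le \<xi> by (auto simp: operator_le_def rep \<omega>_eq complex_nonneg_Reals_iff)
    ultimately show ?thesis using less by (simp add: N_def U_def)
  qed
  ultimately have "\<forall>\<^sub>F H in finite_subsets_at_top J. universal_rep (?G H) \<in> N"
    using lim by (simp add: limitin_def)
  then obtain X where X: "finite X \<and> X \<subseteq> J
      \<and> (\<forall>H. finite H \<and> X \<subseteq> H \<and> H \<subseteq> J \<longrightarrow> universal_rep (?G H) \<in> N)"
    unfolding eventually_finite_subsets_at_top by (rule exE) (rule that)
  then have "universal_rep (?G (X \<union> F)) \<in> N" using F by simp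
  then have "Re (\<phi> (?G (X \<union> F))) < Re (\<phi> (?G F))" by (simp add: N_def U_def \<omega>_eq rep)
  moreover have "Re (\<phi> (?G F)) \<le> Re (\<phi> (?G (X \<union> F)))"
    using X F(1) by (auto simp: state_linear[OF \<phi>] state_positive[OF \<phi>] intro!: sum_mono2)
  ultimately show False by simp
qed

text \<open>The upper frame inequality is applied to the partial sum \<open>y\<close> itself.\<close>

lemma norm_partial_sum_le:
  fixes x :: "'j \<Rightarrow> 'b"
  defines "y \<equiv> \<lambda>F. \<Sum>j\<in>F. x j * star (x j)"
  assumes F: "finite F" "F \<subseteq> J" and "0 < c"
    and lim: "limitin ultraweak_topology
        (\<lambda>H. universal_rep (\<Sum>j\<in>H. (star (y F) * x j) * (star (x j) * y F))) T
        (finite_subsets_at_top J)"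
    and le: "operator_le T (universal_rep (c *\<^sub>R (star (y F) * y F)))"
  shows "norm (y F) \<le> c"
  unfolding y_def
proof (rule norm_sum_mult_star_le[OF _ \<open>0 < c\<close>], fold y_def)
  fix \<phi> :: "'b \<Rightarrow> complex" assume \<phi>: "state \<phi>"
  have sy: "star (y F) = y F" by (simp add: y_def star_sum star_mult star_star)
  define g where "g j = star (x j) * y F" for j
  have g: "(star (y F) * x j) * (star (x j) * y F) = star (g j) * g j" for j
    by (simp add: g_def star_mult star_star)
  have "y F * y F * y F = (\<Sum>j\<in>F. star (g j) * g j)"
    unfolding g[symmetric] sy
    by (subst (2) y_def) (simp add: sum_distrib_left sum_distrib_right mult.assoc)
  then have "Re (\<phi> (y F * y F * y F)) \<le> Re (\<phi> (c *\<^sub>R (star (y F) * y F)))"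
    using state_partial_sum_le[OF lim[unfolded g] le F \<phi>] by simp
  then show "Re (\<phi> (y F * y F * y F)) \<le> c * Re (\<phi> (y F * y F))"
    by (simp add: state_linear[OF \<phi>] sy)
qed

end

section \<open>The bound for both kinds of coefficient algebra\<close>

lemma unitization_embed_simps:
  "unitization_embed a * unitization_embed b = unitization_embed (a * b)"
  "star (unitization_embed a) = unitization_embed (star a)"
  "r *\<^sub>R unitization_embed a = unitization_embed (r *\<^sub>R a)"
  "norm (unitization_embed a) = norm a"
  by (simp_all add: unitization_embed_def unitization_ops' norm_unitization_def op_norm_alg)

lemma unitization_embed_add: "unitization_embed (a + b) = unitization_embed a + unitization_embed b"
  by (simp add: unitization_embed_def plus_unitization_def)

lemma unitization_embed_zero: "unitization_embed 0 = 0"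
  by (simp add: unitization_embed_def zero_unitization_def)

lemma unitization_embed_sum:
  "unitization_embed (\<Sum>i\<in>I. f i) = (\<Sum>i\<in>I. unitization_embed (f i))"
  by (induction I rule: infinite_finite_induct)
    (simp_all add: unitization_embed_add unitization_embed_zero)

theorem theorem4p1:
  fixes x :: "'j \<Rightarrow> 'a::cstar_algebra" and J :: "'j set"
  assumes "algebra_frame x J"
  shows "bounded ((\<lambda>F. \<Sum>j\<in>F. x j * star (x j)) ` {F. finite F \<and> F \<subseteq> J})"
proof -
  define S where "S F = (\<Sum>j\<in>F. x j * star (x j))" for F
  have "\<exists>c. \<forall>F. finite F \<and> F \<subseteq> J \<longrightarrow> norm (S F) \<le> c"
  proof (cases "unital TYPE('a)")
    case True
    then obtain e :: 'a where "is_unit_element e" by (auto simp: unital_def)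
    then interpret unital_cstar_algebra e by unfold_locales
    interpret hilbert_cstar_module "self_act :: 'a \<Rightarrow> _" self_ip
      by (rule hilbert_cstar_module_self[OF True])
    have "frame x J" using assms True by (simp add: algebra_frame_def)
    then obtain c where c: "0 < c" and lim: "\<And>y. \<exists>T. limitin ultraweak_topology
          (\<lambda>F. universal_rep (\<Sum>j\<in>F. self_ip y (x j) * self_ip (x j) y)) T (finite_subsets_at_top J)
        \<and> operator_le T (universal_rep (c *\<^sub>R self_ip y y))"
      unfolding frame_def by blast
    have "norm (S F) \<le> c" if F: "finite F" "F \<subseteq> J" for F
      using lim[of "S F"] norm_partial_sum_le[OF F c, of x]
      by (auto simp: self_ip_def S_def)
    then show ?thesis by blast
  next
    case False
    interpret unital_cstar_algebra "Unitization (0::'a) 1"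
      by unfold_locales (rule is_unit_element_unitization)
    interpret hilbert_cstar_module "unitization_act :: 'a \<Rightarrow> _" unitization_ip
      by (rule hilbert_cstar_module_unitization)
    have "frame x J" using assms False by (simp add: algebra_frame_def)
    then obtain c where c: "0 < c" and lim: "\<And>y. \<exists>T. limitin ultraweak_topology
          (\<lambda>F. universal_rep (\<Sum>j\<in>F. unitization_ip y (x j) * unitization_ip (x j) y)) T
          (finite_subsets_at_top J)
        \<and> operator_le T (universal_rep (c *\<^sub>R unitization_ip y y))"
      unfolding frame_def by blast
    have "norm (S F) \<le> c" if F: "finite F" "F \<subseteq> J" for F
    proof -
      have "(\<Sum>j\<in>F. unitization_embed (x j) * star (unitization_embed (x j))) = unitization_embed (S F)"
        by (simp add: S_def unitization_embed_sum unitization_embed_simps)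
      then have "norm (unitization_embed (S F)) \<le> c"
        using lim[of "S F"] norm_partial_sum_le[OF F c, of "\<lambda>j. unitization_embed (x j)"]
        by (auto simp: unitization_ip_def unitization_embed_simps)
      then show ?thesis by (simp add: unitization_embed_simps)
    qed
    then show ?thesis by blast
  qed
  then show ?thesis by (auto simp: bounded_iff S_def)
qed

end
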